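(* Let $\mathbb{F}$ be an algebraically closed field and $T\in\mathbb{F}^{n_1\times n_2\times n_3}$. Then $\mathrm{GR}(T)\le \mathrm{ZR}(T)\le \mathrm{SR}(T)$.
   Context: For $T\in\mathbb{F}^{n_1\times n_2\times n_3}$ write $T(x,y,z)=\sum_{i,j,k}T_{i,j,k}x_iy_jz_k$ and let $\mathbf{V}(T)=\{(x,y)\in\mathbb{F}^{n_1}\times\mathbb{F}^{n_2}: T(x,y,z)=0 \text{ for all } z\in\mathbb{F}^{n_3}\}$. The geometric rank is $\mathrm{GR}(T)=\operatorname{codim}\mathbf{V}(T)=n_1+n_2-\dim\mathbf{V}(T)$. For polynomials $f_1,\dots,f_s$, $\mathbf{V}(f_1,\dots,f_s)$ denotes their common zero set. Let $P$ be the set of polynomials in $\mathbb{F}[x_1,\dots,x_{n_1},y_1,\dots,y_{n_2}]$ that are bi-homogeneous of bi-degree $(1,0)$, $(0,1)$ or $(1,1)$ (i.e. linear forms in $x$ only, linear forms in $y$ only, or bilinear forms in $(x,y)$). Define $\mathrm{ZR}(T)=\min\{s\in\mathbb{N}: \exists f_1,\dots,f_s\in P \text{ with } \mathbf{V}(f_1,\dots,f_s)\subseteq\mathbf{V}(T)\}$. The slice rank $\mathrm{SR}(T)$ is the smallest $r$ such that $T$ is a sum of $r$ tensors each of the form $(u_iV_{jk})_{i,j,k}$, $(u_jV_{ik})_{i,j,k}$ or $(u_kV_{ij})_{i,j,k}$ for a vector $u$ and matrix $V$. *)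

theory Defs
  imports
    "HOL-Analysis.Finite_Cartesian_Product"
    "HOL-Computational_Algebra.Polynomial"
    "HOL-Library.Poly_Mapping"
    "HOL-Library.Extended_Nat"
begin

subsection \<open>Affine algebraic sets and their dimension\<close>

text \<open>Polynomials over \<open>'a\<close> in the variables \<open>'v\<close>: finitely supported coefficient functions on
  exponent vectors.\<close>

type_synonym ('v, 'a) mpolynomial = "('v \<Rightarrow>\<^sub>0 nat) \<Rightarrow>\<^sub>0 'a"

definition eval_mpoly :: "('v::finite, 'a::comm_semiring_1) mpolynomial \<Rightarrow> ('v \<Rightarrow> 'a) \<Rightarrow> 'a" where
  "eval_mpoly p a =
     (\<Sum>m\<in>Poly_Mapping.keys p. Poly_Mapping.lookup p m * (\<Prod>v\<in>UNIV. a v ^ Poly_Mapping.lookup m v))"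

definition zero_locus :: "('v::finite, 'a::comm_semiring_1) mpolynomial set \<Rightarrow> ('v \<Rightarrow> 'a) set" where
  "zero_locus F = {a. \<forall>f\<in>F. eval_mpoly f a = 0}"

definition algebraic_set :: "('v::finite \<Rightarrow> 'a::comm_semiring_1) set \<Rightarrow> bool" where
  "algebraic_set S \<longleftrightarrow> (\<exists>F. S = zero_locus F)"

definition irreducible_algebraic_set :: "('v::finite \<Rightarrow> 'a::comm_semiring_1) set \<Rightarrow> bool" where
  "irreducible_algebraic_set S \<longleftrightarrow> algebraic_set S \<and> S \<noteq> {} \<and>
     (\<forall>A B. algebraic_set A \<and> algebraic_set B \<and> S = A \<union> B \<longrightarrow> A = S \<or> B = S)"

text \<open>The dimension of an algebraic set: the supremum of the lengths \<open>n\<close> of chains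
  \<open>Z\<^sub>0 \<subset> Z\<^sub>1 \<subset> \<dots> \<subset> Z\<^sub>n\<close> of irreducible algebraic subsets.  With this convention the empty set
  gets dimension \<open>0\<close>; it is only applied to nonempty sets below.\<close>

definition dim_alg :: "('v::finite \<Rightarrow> 'a::comm_semiring_1) set \<Rightarrow> enat" where
  "dim_alg S = Sup {enat n | n. \<exists>Z. (\<forall>i\<le>n. irreducible_algebraic_set (Z i) \<and> Z i \<subseteq> S) \<and>
                                   (\<forall>i<n. Z i \<subset> Z (Suc i))}"

subsection \<open>Tensors\<close>

type_synonym ('a, 'n1, 'n2, 'n3) tensor = "'a ^ 'n3 ^ 'n2 ^ 'n1"

definition trilinear :: "('a::comm_semiring_1, 'n1::finite, 'n2::finite, 'n3::finite) tensor \<Rightarrow>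
    'a ^ 'n1 \<Rightarrow> 'a ^ 'n2 \<Rightarrow> 'a ^ 'n3 \<Rightarrow> 'a" where
  "trilinear T x y z = (\<Sum>i\<in>UNIV. \<Sum>j\<in>UNIV. \<Sum>k\<in>UNIV. T $ i $ j $ k * x $ i * y $ j * z $ k)"

definition tensor_variety :: "('a::comm_semiring_1, 'n1::finite, 'n2::finite, 'n3::finite) tensor \<Rightarrow>
    (('a ^ 'n1) \<times> ('a ^ 'n2)) set" where
  "tensor_variety T = {(x, y). \<forall>z. trilinear T x y z = 0}"

text \<open>A pair \<open>(x, y)\<close> is a point of the affine space with coordinates indexed by \<open>'n1 + 'n2\<close>: the
  variable \<open>Inl i\<close> stands for \<open>x\<^sub>i\<close> and \<open>Inr j\<close> for \<open>y\<^sub>j\<close>.\<close>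

definition pair_point :: "('a ^ 'n1) \<times> ('a ^ 'n2) \<Rightarrow> 'n1::finite + 'n2::finite \<Rightarrow> 'a" where
  "pair_point p = (\<lambda>v. case v of Inl i \<Rightarrow> fst p $ i | Inr j \<Rightarrow> snd p $ j)"

text \<open>The subtraction on \<^typ>\<open>enat\<close> does not truncate here, since the variety lies in an affine space of
  dimension \<open>n\<^sub>1 + n\<^sub>2\<close>.\<close>

definition geometric_rank ::
    "('a::comm_semiring_1, 'n1::finite, 'n2::finite, 'n3::finite) tensor \<Rightarrow> enat" where
  "geometric_rank T = enat (CARD('n1) + CARD('n2)) - dim_alg (pair_point ` tensor_variety T)"

definition bihomogeneous ::
    "nat \<Rightarrow> nat \<Rightarrow> ('n1::finite + 'n2::finite, 'a::comm_semiring_1) mpolynomial \<Rightarrow> bool" where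
  "bihomogeneous d e p \<longleftrightarrow> (\<forall>m\<in>Poly_Mapping.keys p.
     (\<Sum>i\<in>UNIV. Poly_Mapping.lookup m (Inl i)) = d \<and> (\<Sum>j\<in>UNIV. Poly_Mapping.lookup m (Inr j)) = e)"

definition bilinear_polys ::
    "('n1::finite + 'n2::finite, 'a::comm_semiring_1) mpolynomial set" where
  "bilinear_polys = {f. bihomogeneous 1 0 f \<or> bihomogeneous 0 1 f \<or> bihomogeneous 1 1 f}"

text \<open>The polynomials \<open>f\<^sub>1, \<dots>, f\<^sub>s\<close> are given as a list of length \<open>s\<close>.\<close>

definition zero_rank ::
    "('a::comm_semiring_1, 'n1::finite, 'n2::finite, 'n3::finite) tensor \<Rightarrow> nat" where
  "zero_rank T = (LEAST s. \<exists>fs :: ('n1 + 'n2, 'a) mpolynomial list.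
     length fs = s \<and> set fs \<subseteq> bilinear_polys \<and>
     zero_locus (set fs) \<subseteq> pair_point ` tensor_variety T)"

definition slice_tensor ::
    "('a::comm_semiring_1, 'n1::finite, 'n2::finite, 'n3::finite) tensor \<Rightarrow> bool" where
  "slice_tensor S \<longleftrightarrow>
     (\<exists>(u :: 'a ^ 'n1) (V :: 'a ^ 'n3 ^ 'n2). S = (\<chi> i j k. u $ i * V $ j $ k)) \<or>
     (\<exists>(u :: 'a ^ 'n2) (V :: 'a ^ 'n3 ^ 'n1). S = (\<chi> i j k. u $ j * V $ i $ k)) \<or>
     (\<exists>(u :: 'a ^ 'n3) (V :: 'a ^ 'n2 ^ 'n1). S = (\<chi> i j k. u $ k * V $ i $ j))"

definition slice_rank ::
    "('a::comm_semiring_1, 'n1::finite, 'n2::finite, 'n3::finite) tensor \<Rightarrow> nat" where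
  "slice_rank T = (LEAST r. \<exists>Ss :: ('a, 'n1, 'n2, 'n3) tensor list.
     length Ss = r \<and> (\<forall>S\<in>set Ss. slice_tensor S) \<and> T = sum_list Ss)"

end

theory Submission
  imports Defs "HOL-Library.Function_Algebras"
begin

text \<open>Each slice of \<open>T\<close> has a factor of bidegree \<open>(1, 0)\<close>, \<open>(0, 1)\<close> or \<open>(1, 1)\<close> whose zeros annihilate
  it, which gives \<open>ZR \<le> SR\<close>.

  For \<open>GR \<le> ZR\<close>, the point is that \<open>s\<close> forms \<open>f\<^sub>1, \<dots>, f\<^sub>s\<close> of positive degree in \<open>n > s\<close> variables have a
  zero set of dimension at least \<open>n - s\<close>.  If the ideal \<open>I\<close> of the \<open>f\<^sub>i\<close> contained a nonzero polynomial in
  the variables \<open>V\<close> for every set \<open>V\<close> of \<open>n - s\<close> variables, then division by homogeneous ones would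
  leave \<open>O(D ^ (n - s - 1))\<close> standard monomials of degree at most \<open>D\<close>, and their products with the
  monomials in the \<open>f\<^sub>i\<close> would be too few to span all polynomials of degree at most \<open>D\<close>.  So some \<open>V\<close>
  satisfies \<open>I \<inter> F[V] = 0\<close>, and \<open>I\<close> extends to a prime ideal \<open>p\<close> with \<open>p \<inter> F[V] = 0\<close>.  Adjoining
  \<open>x\<^sub>v - c\<close> to \<open>p\<close> for a generic constant \<open>c\<close> keeps the ideal disjoint from \<open>F[V - {v}] - {0}\<close>;
  repeating this yields a chain of primes of length \<open>n - s\<close>, and by the Nullstellensatz a chain of
  irreducible closed subsets.

  Since the field is infinite, polynomials are represented by the functions they define.\<close>

subsection \<open>Polynomial functions\<close>

text \<open>With the pointwise ring operations on functions, these rules would turn \<open>f * g\<close> into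
  \<open>\<lambda>a. f a * g a\<close> under eta-expansion.\<close>

declare plus_fun_apply [simp del] times_fun_apply [simp del] minus_apply [simp del] uminus_apply [simp del]
  zero_fun_apply [simp del] one_fun_apply [simp del]

lemmas fun_arith_apply = plus_fun_apply times_fun_apply minus_apply uminus_apply zero_fun_apply one_fun_apply

text \<open>F[V] is realised inside the functions on the full space, whatever V is, so that
  inclusions between these rings are set inclusions and an ideal can be intersected with each of
  them.\<close>

inductive_set polyfun :: "'v set \<Rightarrow> (('v \<Rightarrow> 'a::comm_ring_1) \<Rightarrow> 'a) set" for V where
  const: "(\<lambda>_. c) \<in> polyfun V"
| var: "v \<in> V \<Longrightarrow> (\<lambda>a. a v) \<in> polyfun V"
| add: "f \<in> polyfun V \<Longrightarrow> g \<in> polyfun V \<Longrightarrow> f + g \<in> polyfun V"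
| mult: "f \<in> polyfun V \<Longrightarrow> g \<in> polyfun V \<Longrightarrow> f * g \<in> polyfun V"

lemma sum_fun_apply: "(\<Sum>i\<in>A. f i) a = (\<Sum>i\<in>A. f i a)"
  by (induction A rule: infinite_finite_induct) (auto simp: fun_arith_apply)

lemma prod_fun_apply: "(\<Prod>i\<in>A. f i) a = (\<Prod>i\<in>A. f i a)"
  by (induction A rule: infinite_finite_induct) (auto simp: fun_arith_apply)

lemma power_fun_apply: "(f ^ n) a = f a ^ n"
  by (induction n) (auto simp: fun_arith_apply)

lemma polyfun_0: "0 \<in> polyfun V"
  using polyfun.const[of 0 V] by (simp add: zero_fun_def)

lemma polyfun_1: "1 \<in> polyfun V"
  using polyfun.const[of 1 V] by (simp add: one_fun_def)

lemma polyfun_uminus: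
  assumes "f \<in> polyfun V" shows "- f \<in> polyfun V"
proof -
  have "(\<lambda>_. - 1) * f = - f" by (auto simp: fun_eq_iff fun_arith_apply)
  then show ?thesis using polyfun.mult[OF polyfun.const[of "-1"] assms] by simp
qed

lemma polyfun_diff: "f \<in> polyfun V \<Longrightarrow> g \<in> polyfun V \<Longrightarrow> f - g \<in> polyfun V"
  using polyfun.add[of f V "- g"] polyfun_uminus[of g V] by simp

lemma polyfun_sum: "(\<And>i. i \<in> A \<Longrightarrow> f i \<in> polyfun V) \<Longrightarrow> (\<Sum>i\<in>A. f i) \<in> polyfun V"
  by (induction A rule: infinite_finite_induct) (simp_all add: polyfun_0 polyfun.add)

lemma polyfun_prod: "(\<And>i. i \<in> A \<Longrightarrow> f i \<in> polyfun V) \<Longrightarrow> (\<Prod>i\<in>A. f i) \<in> polyfun V"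
  by (induction A rule: infinite_finite_induct) (simp_all add: polyfun_1 polyfun.mult)

lemma polyfun_power: "f \<in> polyfun V \<Longrightarrow> f ^ n \<in> polyfun V"
  by (induction n) (simp_all add: polyfun_1 polyfun.mult)

lemma polyfun_mono:
  assumes "V \<subseteq> W" shows "polyfun V \<subseteq> polyfun W"
proof
  fix f :: "('a \<Rightarrow> 'b) \<Rightarrow> 'b" assume "f \<in> polyfun V"
  then show "f \<in> polyfun W"
    by induction (use assms in \<open>blast intro: polyfun.intros\<close>)+
qed

lemma polyfun_UNIV: "f \<in> polyfun V \<Longrightarrow> f \<in> polyfun UNIV"
  using polyfun_mono[of V UNIV] by auto

lemma polyfun_cong:
  assumes "f \<in> polyfun V" and "\<And>v. v \<in> V \<Longrightarrow> a v = b v"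
  shows "f a = f b"
  using assms(1) by induction (auto simp: assms(2) fun_arith_apply)

lemma polyfun_empty:
  assumes "f \<in> polyfun {}" shows "\<exists>c. f = (\<lambda>_. c)"
  using polyfun_cong[OF assms] by (intro exI[of _ "f undefined"]) (auto simp: fun_eq_iff fun_arith_apply)

text \<open>Restriction to a line reduces nonvanishing in several variables to nonvanishing of a
  univariate polynomial, which has only finitely many roots.\<close>

lemma polyfun_restrict_line:
  assumes "f \<in> polyfun V"
  shows "\<exists>q. \<forall>t. f (\<lambda>v. a v + t * b v) = poly q t"
  using assms
proof induction
  case (const c)
  then show ?case by (intro exI[of _ "[:c:]"]) auto
next
  case (var v)
  then show ?case by (intro exI[of _ "[:a v, b v:]"]) auto
next
  case (add f g)
  then show ?case by (auto simp: fun_arith_apply simp flip: poly_add)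
next
  case (mult f g)
  then show ?case by (auto simp: fun_arith_apply simp flip: poly_mult)
qed

text \<open>Over a finite field, 1 plus the product of all X - a would be nonconstant without a
  root.\<close>

lemma infinite_UNIV_alg_closed: "infinite (UNIV :: 'a::alg_closed_field set)"
proof
  assume fin: "finite (UNIV :: 'a set)"
  define q where "q = (\<Prod>a\<in>(UNIV :: 'a set). [:- a, 1:])"
  have "degree q = card (UNIV :: 'a set)"
    unfolding q_def by (subst degree_prod_eq_sum_degree) (auto simp: fin)
  moreover have "card (UNIV :: 'a set) > 0" using fin by (simp add: card_gt_0_iff)
  ultimately have "degree 1 < degree q" by simp
  then have "degree (q + 1) > 0" by (simp add: degree_add_eq_left)
  then obtain x where "poly (q + 1) x = 0" using alg_closed_imp_poly_has_root by blast
  moreover have "poly q x = 0" using fin by (auto simp: poly_prod q_def)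
  ultimately show False by simp
qed

lemma poly_nonroot_exists:
  fixes q :: "'a::alg_closed_field poly"
  assumes "q \<noteq> 0" shows "\<exists>t. poly q t \<noteq> 0"
proof (rule ccontr)
  assume "\<not> ?thesis"
  then have "{t. poly q t = 0} = UNIV" by auto
  then show False using poly_roots_finite[OF assms] infinite_UNIV_alg_closed[where 'a = 'a] by simp
qed

text \<open>The leading coefficient need not be invertible, so each division step costs one more
  factor \<open>coeff e m\<close>. In the applications the coefficient type consists of all
  functions and \<open>A\<close> is F[V]; tracking \<open>A\<close> keeps quotient and remainder
  over F[V]. The number \<open>n\<close> bounds the count of coefficients, not the degree, so that
  the zero polynomial is the base case.\<close>

lemma pseudo_division:
  fixes c e :: "'r::comm_ring_1 poly"
  assumes A: "0 \<in> A" "\<And>x y. x \<in> A \<Longrightarrow> y \<in> A \<Longrightarrow> x - y \<in> A" "\<And>x y. x \<in> A \<Longrightarrow> y \<in> A \<Longrightarrow> x * y \<in> A"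
    and e: "\<And>i. coeff e i \<in> A" "\<And>i. i > m \<Longrightarrow> coeff e i = 0"
    and c: "\<And>i. coeff c i \<in> A" "\<And>i. i \<ge> n \<Longrightarrow> coeff c i = 0"
  shows "\<exists>k Q R. smult (coeff e m ^ k) c = Q * e + R \<and> (\<forall>i. coeff Q i \<in> A) \<and> (\<forall>i. coeff R i \<in> A) \<and>
    (\<forall>i\<ge>m. coeff R i = 0) \<and> (\<forall>i. n \<le> i + m \<longrightarrow> coeff Q i = 0)"
  using c
proof (induction n arbitrary: c)
  case 0
  then have "c = 0" by (intro poly_eqI) auto
  then show ?case using A(1) by (intro exI[of _ 0]) auto
next
  case (Suc n)
  show ?case
  proof (cases "n < m")
    case True
    then show ?thesis using Suc.prems A(1)
      by (intro exI[of _ 0] exI[of _ "0::'r poly"] exI[of _ c]) auto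
  next
    case False
    have plusA: "x + y \<in> A" if "x \<in> A" "y \<in> A" for x y
      using A(2)[OF that(1) A(2)[OF A(1) that(2)]] by simp
    let ?t = "monom (coeff c n) (n - m)"
    let ?c = "smult (coeff e m) c - ?t * e"
    have coef: "coeff (?t * e) i = (if i < n - m then 0 else coeff c n * coeff e (i - (n - m)))" for i
      by (simp add: coeff_monom_mult)
    have 1: "coeff ?c i \<in> A" for i
      using A e(1) Suc.prems(1) by (simp add: coef)
    have 2: "coeff ?c i = 0" if "i \<ge> n" for i
    proof (cases "i = n")
      case True
      then show ?thesis using False by (simp add: coef mult.commute[of "coeff e m"])
    next
      case False
      with that \<open>\<not> n < m\<close> have "i - (n - m) > m" by auto
      with False that show ?thesis using Suc.prems(2)[of i] e(2) by (auto simp: coef)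
    qed
    from Suc.IH[of ?c, OF 1 2] obtain k Q R where
      IH: "smult (coeff e m ^ k) ?c = Q * e + R" "\<forall>i. coeff Q i \<in> A" "\<forall>i. coeff R i \<in> A"
        "\<forall>i\<ge>m. coeff R i = 0" "\<forall>i. n \<le> i + m \<longrightarrow> coeff Q i = 0" by blast
    let ?Q = "Q + smult (coeff e m ^ k) ?t"
    have "smult (coeff e m ^ Suc k) c = ?Q * e + R"
      using IH(1) by (simp add: algebra_simps smult_diff_right)
    moreover have pw: "coeff e m ^ k * coeff c n \<in> A"
      by (induction k) (auto simp: mult.assoc A(3) e(1) Suc.prems(1))
    have "\<forall>i. coeff ?Q i \<in> A"
      using IH(2) pw A(1) plusA by (auto simp: coeff_monom)
    moreover have "\<forall>i. Suc n \<le> i + m \<longrightarrow> coeff ?Q i = 0"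
      using IH(5) False by auto
    ultimately show ?thesis using IH(3,4) by blast
  qed
qed

section \<open>Polynomials in one coordinate with coefficients in F[V]\<close>

definition coeffs_in :: "'r::comm_ring_1 set \<Rightarrow> 'r poly set" where
  "coeffs_in A = {c. \<forall>i. coeff c i \<in> A}"

lemma poly_coord_apply: "poly c (\<lambda>a. a v) b = poly (map_poly (\<lambda>f. f b) c) (b v)"
  for c :: "(('v \<Rightarrow> 'a::comm_ring_1) \<Rightarrow> 'a) poly"
  by (induction c) (auto simp: map_poly_pCons fun_arith_apply)

text \<open>This is F[V, x_v] = F[V][x_v]; it makes univariate division available for polynomial
  functions.\<close>

lemma polyfun_insert:
  "polyfun (insert v V) = (\<lambda>c. poly c (\<lambda>a. a v)) ` coeffs_in (polyfun V :: (('v \<Rightarrow> 'a::comm_ring_1) \<Rightarrow> 'a) set)"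
proof (intro equalityI subsetI)
  fix f :: "('v \<Rightarrow> 'a) \<Rightarrow> 'a" assume "f \<in> polyfun (insert v V)"
  then show "f \<in> (\<lambda>c. poly c (\<lambda>a. a v)) ` coeffs_in (polyfun V)"
  proof induction
    case (const c)
    then show ?case
      by (intro image_eqI[of _ _ "[:\<lambda>_. c:]"])
        (auto simp: coeffs_in_def coeff_pCons polyfun_0 intro: polyfun.const split: nat.split)
  next
    case (var u)
    show ?case
    proof (cases "u = v")
      case True
      then show ?thesis
        by (intro image_eqI[of _ _ "[:0, 1:]"])
          (auto simp: coeffs_in_def coeff_pCons polyfun_0 polyfun_1 split: nat.split)
    next
      case False
      with var show ?thesis
        by (intro image_eqI[of _ _ "[:\<lambda>a. a u:]"])
          (auto simp: coeffs_in_def coeff_pCons polyfun_0 intro: polyfun.var split: nat.split)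
    qed
  next
    case (add f g)
    then obtain c d where "f = poly c (\<lambda>a. a v)" "g = poly d (\<lambda>a. a v)"
      "c \<in> coeffs_in (polyfun V)" "d \<in> coeffs_in (polyfun V)" by auto
    then show ?case
      by (intro image_eqI[of _ _ "c + d"]) (auto simp: coeffs_in_def intro: polyfun.add)
  next
    case (mult f g)
    then obtain c d where "f = poly c (\<lambda>a. a v)" "g = poly d (\<lambda>a. a v)"
      "c \<in> coeffs_in (polyfun V)" "d \<in> coeffs_in (polyfun V)" by auto
    then show ?case
      by (intro image_eqI[of _ _ "c * d"])
        (auto simp: coeffs_in_def coeff_mult intro!: polyfun_sum polyfun.mult)
  qed
next
  fix f :: "('v \<Rightarrow> 'a) \<Rightarrow> 'a" assume "f \<in> (\<lambda>c. poly c (\<lambda>a. a v)) ` coeffs_in (polyfun V)"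
  then show "f \<in> polyfun (insert v V)"
    using polyfun_mono[of V "insert v V"]
    by (auto simp: poly_altdef coeffs_in_def intro!: polyfun_sum polyfun.mult polyfun_power polyfun.var)
qed

text \<open>The coefficients do not see the coordinate v. Choosing that coordinate thus becomes a
  question about roots of one univariate polynomial over the field.\<close>

lemma polyfun_insert_update:
  assumes "c \<in> coeffs_in (polyfun V)" "v \<notin> V"
  shows "poly c (\<lambda>a. a v) (a(v := t)) = poly (map_poly (\<lambda>f. f a) c) t"
proof -
  have "map_poly (\<lambda>f. f (a(v := t))) c = map_poly (\<lambda>f. f a) c"
  proof (rule poly_eqI)
    fix i
    have "coeff c i (a(v := t)) = coeff c i a"
      by (rule polyfun_cong[of _ V]) (use assms in \<open>auto simp: coeffs_in_def\<close>)
    then show "coeff (map_poly (\<lambda>f. f (a(v := t))) c) i = coeff (map_poly (\<lambda>f. f a) c) i"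
      by (simp add: coeff_map_poly zero_fun_apply)
  qed
  then show ?thesis by (simp add: poly_coord_apply)
qed

section \<open>Ideals and prime ideals of the ring \<open>polyfun UNIV\<close>, a subring of all
  functions\<close>

definition polyfun_ideal :: "(('v \<Rightarrow> 'a::comm_ring_1) \<Rightarrow> 'a) set \<Rightarrow> bool" where
  "polyfun_ideal I \<longleftrightarrow> I \<subseteq> polyfun UNIV \<and> 0 \<in> I \<and> (\<forall>f\<in>I. \<forall>g\<in>I. f + g \<in> I) \<and>
     (\<forall>f\<in>polyfun UNIV. \<forall>g\<in>I. f * g \<in> I)"

definition polyfun_prime :: "(('v \<Rightarrow> 'a::comm_ring_1) \<Rightarrow> 'a) set \<Rightarrow> bool" where
  "polyfun_prime p \<longleftrightarrow> polyfun_ideal p \<and> 1 \<notin> p \<and>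
     (\<forall>f\<in>polyfun UNIV. \<forall>g\<in>polyfun UNIV. f * g \<in> p \<longrightarrow> f \<in> p \<or> g \<in> p)"

lemma polyfun_idealD:
  assumes "polyfun_ideal I"
  shows "I \<subseteq> polyfun UNIV" "0 \<in> I" "\<And>f g. f \<in> I \<Longrightarrow> g \<in> I \<Longrightarrow> f + g \<in> I"
    "\<And>f g. f \<in> polyfun UNIV \<Longrightarrow> g \<in> I \<Longrightarrow> f * g \<in> I"
    "\<And>f g. f \<in> I \<Longrightarrow> g \<in> polyfun UNIV \<Longrightarrow> f * g \<in> I"
  using assms unfolding polyfun_ideal_def by (blast, blast, blast, blast, metis mult.commute)

lemma polyfun_ideal_diff:
  assumes "polyfun_ideal I" "f \<in> I" "g \<in> I" shows "f - g \<in> I"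
proof -
  have "(\<lambda>_. - 1) * g = - g" by (auto simp: fun_eq_iff fun_arith_apply)
  then have "- g \<in> I" using polyfun_idealD(4)[OF assms(1) polyfun.const[of "-1"] assms(3)] by simp
  then show ?thesis using polyfun_idealD(3)[OF assms(1,2)] by fastforce
qed

lemma polyfun_ideal_sum:
  "polyfun_ideal I \<Longrightarrow> (\<And>i. i \<in> A \<Longrightarrow> f i \<in> I) \<Longrightarrow> (\<Sum>i\<in>A. f i) \<in> I"
  by (induction A rule: infinite_finite_induct) (simp_all add: polyfun_idealD)

lemma polyfun_primeD:
  assumes "polyfun_prime p"
  shows "polyfun_ideal p" "1 \<notin> p"
    "\<And>f g. f \<in> polyfun UNIV \<Longrightarrow> g \<in> polyfun UNIV \<Longrightarrow> f * g \<in> p \<Longrightarrow> f \<in> p \<or> g \<in> p"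
  using assms by (auto simp: polyfun_prime_def)

lemma polyfun_prime_power:
  assumes "polyfun_prime p" "f \<in> polyfun UNIV" "f \<notin> p" shows "f ^ n \<notin> p"
  using assms(3)
proof (induction n)
  case (Suc n)
  then show ?case using polyfun_primeD(3)[OF assms(1,2) polyfun_power[OF assms(2)]] assms(3) by auto
qed (use assms(1) in \<open>simp add: polyfun_primeD(2)\<close>)

subsection \<open>Extension of zeros of a prime ideal\<close>

lemma coeffs_inD: "c \<in> coeffs_in A \<Longrightarrow> coeff c i \<in> A"
  by (simp add: coeffs_in_def)

lemma poly_coord_in_ideal:
  fixes c :: "(('v \<Rightarrow> 'a::comm_ring_1) \<Rightarrow> 'a) poly"
  assumes "polyfun_ideal p" "\<And>i. coeff c i \<in> p"
  shows "poly c (\<lambda>a. a v) \<in> p"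
  unfolding poly_altdef
proof (intro polyfun_ideal_sum[OF assms(1)])
  fix i
  show "coeff c i * (\<lambda>a. a v) ^ i \<in> p"
    by (rule polyfun_idealD(5)[OF assms(1)]) (auto intro!: assms polyfun_power polyfun.var)
qed

lemma poly_coord_in_polyfun:
  assumes "c \<in> coeffs_in (polyfun V)" shows "poly c (\<lambda>a. a v) \<in> polyfun (insert v V)"
  using assms unfolding polyfun_insert by (rule imageI)

lemma poly_coord_vanishes:
  fixes c :: "(('v \<Rightarrow> 'a::comm_ring_1) \<Rightarrow> 'a) poly"
  assumes "\<And>i. coeff c i a = 0" "c \<in> coeffs_in (polyfun V)" "v \<notin> V"
  shows "poly c (\<lambda>a. a v) (a(v := t)) = 0"
proof -
  have "map_poly (\<lambda>f. f a) c = 0"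
    by (intro poly_eqI) (simp add: coeff_map_poly assms(1) zero_fun_apply)
  then show ?thesis by (simp add: polyfun_insert_update[OF assms(2,3)])
qed

text \<open>The degree is measured modulo \<open>p\<close>, by the last coefficient outside
  \<open>p\<close>. Among the polynomials with \<open>P\<close> one of least such degree is taken,
  and the truncation hypothesis clears its coefficients beyond that place, so that \<open>m\<close>
  becomes its true degree.\<close>

lemma obtain_min_degree:
  fixes P :: "'r::zero poly \<Rightarrow> bool"
  assumes "P c" "coeff c i \<notin> p" "\<And>c n. P c \<Longrightarrow> (\<And>i. i > n \<Longrightarrow> coeff c i \<in> p) \<Longrightarrow> 
     \<exists>c'. P c' \<and> (\<forall>i>n. coeff c' i = 0) \<and> coeff c' n = coeff c n" "0 \<in> p"
  obtains e m where "P e" "coeff e m \<notin> p" "\<And>i. i > m \<Longrightarrow> coeff e i = 0"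
    "\<And>c i. P c \<Longrightarrow> (\<And>i. i \<ge> m \<Longrightarrow> coeff c i \<in> p) \<Longrightarrow> coeff c i \<in> p"
proof -
  define Q where "Q n \<longleftrightarrow> (\<exists>c. P c \<and> coeff c n \<notin> p \<and> (\<forall>i>n. coeff c i \<in> p))" for n
  have ex: "\<exists>n\<le>k. Q n" if c: "P c" "coeff c i \<notin> p" "\<And>i. i > k \<Longrightarrow> coeff c i \<in> p" for c i k
  proof -
    have fin: "finite {i. coeff c i \<notin> p}"
      by (rule finite_subset[of _ "{..k}"]) (use c(3) in \<open>auto simp: not_less[symmetric]\<close>)
    define n where "n = Max {i. coeff c i \<notin> p}"
    have "n \<in> {i. coeff c i \<notin> p}" unfolding n_def using fin c(2) by (intro Max_in) auto
    moreover have "\<forall>i>n. coeff c i \<in> p" using Max_ge[OF fin] unfolding n_def by (meson linorder_not_less mem_Collect_eq)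
    ultimately show ?thesis using c(1,3) unfolding Q_def by (metis linorder_not_less mem_Collect_eq)
  qed
  have "\<exists>n. Q n" using ex[OF assms(1,2), of "degree c"] assms(4) by (auto simp: coeff_eq_0)
  then obtain m where m: "Q m" "\<And>k. k < m \<Longrightarrow> \<not> Q k" by (metis LeastI not_less_Least)
  then obtain c0 where "P c0" "coeff c0 m \<notin> p" "\<forall>i>m. coeff c0 i \<in> p" unfolding Q_def by blast
  with assms(3)[of c0 m] obtain e where e: "P e" "\<forall>i>m. coeff e i = 0" "coeff e m \<notin> p" by auto
  show ?thesis
  proof (rule that[of e m])
    fix c i assume c: "P c" "\<And>i. i \<ge> m \<Longrightarrow> coeff c i \<in> p"
    show "coeff c i \<in> p"
    proof (rule ccontr)
      assume n: "coeff c i \<notin> p"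
      then have "i < m" using c(2) by (meson linorder_not_less)
      then have "\<exists>n\<le>m - 1. Q n" by (intro ex[OF c(1) n]) (use c(2) in auto)
      then show False using m(2) \<open>i < m\<close> by force
    qed
  qed (use e in auto)
qed

text \<open>Generic fibres are nonempty: if a point \<open>a\<close> annihilates the part of the prime \<open>p\<close> not involving
  the coordinate \<open>v\<close>, then \<open>a v\<close> can be chosen freely when \<open>v\<close> is transcendental modulo \<open>p\<close>, and
  otherwise as a root of a minimal polynomial \<open>e\<close> of \<open>v\<close>, provided the leading coefficient of \<open>e\<close> does
  not vanish at \<open>a\<close>.  The polynomial \<open>r\<close> is the constant obtained from \<open>e\<close> and \<open>g\<close> by Euclid's algorithm.\<close>

lemma extend_zero_one_coordinate:
  fixes p :: "(('v \<Rightarrow> 'a::alg_closed_field) \<Rightarrow> 'a) set"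
  assumes p: "polyfun_prime p" and v: "v \<notin> V" and g: "g \<in> polyfun (insert v V)" "g \<notin> p"
  shows "\<exists>g'\<in>polyfun V. g' \<notin> p \<and> (\<forall>a. (\<forall>q\<in>p \<inter> polyfun V. q a = 0) \<and> g' a \<noteq> 0 \<longrightarrow>
    (\<exists>t. (\<forall>q\<in>p \<inter> polyfun (insert v V). q (a(v := t)) = 0) \<and> g (a(v := t)) \<noteq> 0))"
proof -
  let ?A = "polyfun V :: (('v \<Rightarrow> 'a) \<Rightarrow> 'a) set"
  let ?C = "coeffs_in ?A"
  let ?ev = "\<lambda>c :: (('v \<Rightarrow> 'a) \<Rightarrow> 'a) poly. poly c (\<lambda>a. a v)"
  note ideal = polyfun_primeD(1)[OF p]
  note prime = polyfun_primeD(3)[OF p]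
  have A: "0 \<in> ?A" "\<And>x y. x \<in> ?A \<Longrightarrow> y \<in> ?A \<Longrightarrow> x - y \<in> ?A" "\<And>x y. x \<in> ?A \<Longrightarrow> y \<in> ?A \<Longrightarrow> x * y \<in> ?A"
    by (simp_all add: polyfun_0 polyfun_diff polyfun.mult)
  have AU: "x \<in> polyfun UNIV" if "x \<in> ?A" for x using polyfun_UNIV[OF that] .
  have evU: "?ev c \<in> polyfun UNIV" if "c \<in> ?C" for c
    using polyfun_UNIV[OF poly_coord_in_polyfun[OF that]] .
  \<comment> \<open>Cutting off coefficients that lie in \<open>p\<close> changes the value at x_v
    only by an element of \<open>p\<close>.\<close>
  have trunc: "\<exists>c'. (c' \<in> ?C \<and> ?ev c' - ?ev c \<in> p) \<and> (\<forall>i>n. coeff c' i = 0) \<and> coeff c' n = coeff c n"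
    if c: "c \<in> ?C" "\<And>i. i > n \<Longrightarrow> coeff c i \<in> p" for c n
  proof -
    let ?c = "poly_cutoff (Suc n) c"
    have "?ev (?c - c) \<in> p"
    proof (rule poly_coord_in_ideal[OF ideal])
      fix i
      have "- coeff c i \<in> p" if "i > n"
        using polyfun_ideal_diff[OF ideal polyfun_idealD(2)[OF ideal] c(2)[OF that]] by simp
      then show "coeff (?c - c) i \<in> p"
        using polyfun_idealD(2)[OF ideal] by (auto simp: coeff_poly_cutoff)
    qed
    moreover have "?c \<in> ?C" using c(1) by (auto simp: coeffs_in_def coeff_poly_cutoff polyfun_0)
    ultimately show ?thesis by (intro exI[of _ ?c]) (auto simp: coeff_poly_cutoff)
  qed
  obtain cg where cg: "cg \<in> ?C" "g = ?ev cg" using g(1) unfolding polyfun_insert by blast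
  show ?thesis
  proof (cases "\<forall>c\<in>?C. ?ev c \<in> p \<longrightarrow> (\<forall>i. coeff c i \<in> p)")
    \<comment> \<open>Transcendental case: all coefficients of an element of \<open>p\<close> lie in
      \<open>p\<close> and vanish at \<open>a\<close>, so \<open>t\<close> only has to avoid the
      roots of \<open>cg\<close> at \<open>a\<close>.\<close>
    case True
    obtain i where i: "coeff cg i \<notin> p"
      using poly_coord_in_ideal[OF ideal, of cg] g(2) cg(2) by blast
    show ?thesis
    proof (intro bexI[of _ "coeff cg i"] conjI allI impI)
      fix a :: "'v \<Rightarrow> 'a"
      assume a: "(\<forall>q\<in>p \<inter> ?A. q a = 0) \<and> coeff cg i a \<noteq> 0"
      then have "map_poly (\<lambda>f. f a) cg \<noteq> 0"
        by (metis coeff_0 coeff_map_poly zero_fun_apply)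
      then obtain t where t: "poly (map_poly (\<lambda>f. f a) cg) t \<noteq> 0"
        using poly_nonroot_exists by blast
      show "\<exists>t. (\<forall>q\<in>p \<inter> polyfun (insert v V). q (a(v := t)) = 0) \<and> g (a(v := t)) \<noteq> 0"
      proof (intro exI[of _ t] conjI ballI)
        fix q assume q: "q \<in> p \<inter> polyfun (insert v V)"
        then obtain c where c: "c \<in> ?C" "q = ?ev c" unfolding polyfun_insert by blast
        with True q have "coeff c i \<in> p \<inter> ?A" for i by (auto simp: coeffs_inD)
        then show "q (a(v := t)) = 0"
          using a c v by (auto intro: poly_coord_vanishes)
      qed (use t cg v in \<open>simp add: polyfun_insert_update\<close>)
    qed (use i cg in \<open>simp_all add: coeffs_inD\<close>)
  next
    case False
    \<comment> \<open>\<open>P1\<close> describes the relations of x_v over F[V] modulo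
      \<open>p\<close>. Its minimal element \<open>f\<close> is the minimal polynomial of x_v; the
      letter \<open>e\<close> is used below for the result of Euclid's algorithm.\<close>
    define P1 where "P1 c \<longleftrightarrow> c \<in> ?C \<and> ?ev c \<in> p" for c
    from False obtain c1 i1 where c1: "P1 c1" "coeff c1 i1 \<notin> p" unfolding P1_def by blast
    have tr1: "\<exists>c'. P1 c' \<and> (\<forall>i>n. coeff c' i = 0) \<and> coeff c' n = coeff c n"
      if T: "P1 c" "\<And>i. i > n \<Longrightarrow> coeff c i \<in> p" for c n
    proof -
      obtain c' where c': "c' \<in> ?C" "?ev c' - ?ev c \<in> p" "(\<forall>i>n. coeff c' i = 0) \<and> coeff c' n = coeff c n"
        using trunc[of c n] T unfolding P1_def by blast
      have "(?ev c' - ?ev c) + ?ev c \<in> p"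
        by (rule polyfun_idealD(3)[OF ideal c'(2)]) (use T(1) P1_def in blast)
      then show ?thesis using c' unfolding P1_def by auto
    qed
    obtain f n where f: "P1 f" "coeff f n \<notin> p" "\<And>i. i > n \<Longrightarrow> coeff f i = 0"
      and fmin: "\<And>c i. P1 c \<Longrightarrow> (\<And>i. i \<ge> n \<Longrightarrow> coeff c i \<in> p) \<Longrightarrow> coeff c i \<in> p"
      using obtain_min_degree[of P1 c1 i1 p, OF c1 tr1 polyfun_idealD(2)[OF ideal]] by blast
    have fC: "f \<in> ?C" "?ev f \<in> p" using f(1) by (auto simp: P1_def)
    have n0: "n > 0"
    proof (rule ccontr)
      assume "\<not> n > 0"
      then have "f = [:coeff f n:]" using f(3) by (intro poly_eqI) (auto simp: coeff_pCons split: nat.split)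
      then have "?ev f = coeff f n" by (metis mult_zero_right poly_0 poly_pCons add.right_neutral)
      then show False using fC f(2) by simp
    qed
    \<comment> \<open>\<open>P2\<close> describes the polynomials whose value at x_v is, modulo
      \<open>p\<close>, a multiple of \<open>g\<close>. It contains \<open>f\<close> (with
      \<open>u = 0\<close>) and \<open>cg\<close> (with \<open>u = 1\<close>), so its minimal
      element \<open>e\<close> acts as their greatest common divisor.\<close>
    define P2 where "P2 c \<longleftrightarrow> c \<in> ?C \<and> (\<exists>u\<in>?C. ?ev c - ?ev u * g \<in> p)" for c
    have tr2: "\<exists>c'. P2 c' \<and> (\<forall>i>n. coeff c' i = 0) \<and> coeff c' n = coeff c n"
      if T: "P2 c" "\<And>i. i > n \<Longrightarrow> coeff c i \<in> p" for c n
    proof -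
      obtain u where u: "u \<in> ?C" "?ev c - ?ev u * g \<in> p" using T(1) unfolding P2_def by blast
      obtain c' where c': "c' \<in> ?C" "?ev c' - ?ev c \<in> p" "(\<forall>i>n. coeff c' i = 0) \<and> coeff c' n = coeff c n"
        using trunc[of c n] T unfolding P2_def by blast
      have "(?ev c' - ?ev c) + (?ev c - ?ev u * g) \<in> p"
        by (rule polyfun_idealD(3)[OF ideal c'(2) u(2)])
      then have "?ev c' - ?ev u * g \<in> p" by simp
      then show ?thesis using c' u(1) unfolding P2_def by blast
    qed
    have C0: "0 \<in> ?C" and C1: "1 \<in> ?C"
      by (auto simp: coeffs_in_def polyfun_0 polyfun_1 one_pCons coeff_pCons split: nat.split)
    have Cmult: "c * d \<in> ?C" if "c \<in> ?C" "d \<in> ?C" for c d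
      using that by (auto simp: coeffs_in_def coeff_mult intro!: polyfun_sum polyfun.mult)
    have Csmult: "smult s c \<in> ?C" if "s \<in> ?A" "c \<in> ?C" for c s
      using that by (auto simp: coeffs_in_def intro!: polyfun.mult)
    have Cdiff: "c - d \<in> ?C" if "c \<in> ?C" "d \<in> ?C" for c d
      using that by (auto simp: coeffs_in_def intro!: polyfun_diff)
    have "P2 f" unfolding P2_def using fC C0 by (intro conjI bexI[of _ 0]) auto
    obtain e m where e: "P2 e" "coeff e m \<notin> p" "\<And>i. i > m \<Longrightarrow> coeff e i = 0"
      and emin: "\<And>c i. P2 c \<Longrightarrow> (\<And>i. i \<ge> m \<Longrightarrow> coeff c i \<in> p) \<Longrightarrow> coeff c i \<in> p"
      using obtain_min_degree[of P2 f n p, OF \<open>P2 f\<close> f(2) tr2 polyfun_idealD(2)[OF ideal]] by blast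
    obtain u where u: "u \<in> ?C" "?ev e - ?ev u * g \<in> p" and eC: "e \<in> ?C" using e(1) unfolding P2_def by blast
    \<comment> \<open>The remainder modulo \<open>e\<close> satisfies \<open>P2\<close> again in
      degree below \<open>m\<close>, so by minimality all its coefficients lie in \<open>p\<close>:
      up to a power of its leading coefficient, \<open>e\<close> divides every member of
      \<open>P2\<close> modulo \<open>p\<close>.\<close>
    have rem: "\<exists>k Q R. smult (coeff e m ^ k) c = Q * e + R \<and> Q \<in> ?C \<and> R \<in> ?C \<and> (\<forall>i\<ge>m. coeff R i = 0)
        \<and> (\<forall>i. N \<le> i + m \<longrightarrow> coeff Q i = 0) \<and> (\<forall>i. coeff R i \<in> p)"
      if c: "P2 c" "\<And>i. i \<ge> N \<Longrightarrow> coeff c i = 0" for c N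
    proof -
      obtain w where w: "w \<in> ?C" "?ev c - ?ev w * g \<in> p" and cC: "c \<in> ?C" using c(1) unfolding P2_def by blast
      obtain k Q R where kQR: "smult (coeff e m ^ k) c = Q * e + R" "\<forall>i. coeff Q i \<in> ?A" "\<forall>i. coeff R i \<in> ?A"
        "\<forall>i\<ge>m. coeff R i = 0" "\<forall>i. N \<le> i + m \<longrightarrow> coeff Q i = 0"
        using pseudo_division[of ?A e m c N, OF A _ e(3) _ c(2)] coeffs_inD[OF eC] coeffs_inD[OF cC] by blast
      have QR: "Q \<in> ?C" "R \<in> ?C" using kQR by (auto simp: coeffs_in_def)
      have kA: "coeff e m ^ k \<in> ?A" by (intro polyfun_power coeffs_inD[OF eC])
      have R: "R = smult (coeff e m ^ k) c - Q * e" using kQR(1) by simp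
      have "coeff e m ^ k * (?ev c - ?ev w * g) - ?ev Q * (?ev e - ?ev u * g) \<in> p"
        by (intro polyfun_ideal_diff[OF ideal] polyfun_idealD(4)[OF ideal] w u AU kA evU QR)
      also have "coeff e m ^ k * (?ev c - ?ev w * g) - ?ev Q * (?ev e - ?ev u * g) =
          ?ev R - ?ev (smult (coeff e m ^ k) w - Q * u) * g"
        by (simp add: R algebra_simps)
      finally have "P2 R" unfolding P2_def using QR Cdiff[OF Csmult[OF kA w(1)] Cmult[OF QR(1) u(1)]] by blast
      then have "\<forall>i. coeff R i \<in> p" using emin[of R] kQR(4) polyfun_idealD(2)[OF ideal] by auto
      then show ?thesis using kQR QR by blast
    qed
    \<comment> \<open>Since \<open>e\<close> divides \<open>cg\<close>, its value at x_v is not in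
      \<open>p\<close>, otherwise \<open>g\<close> would be. Since \<open>e\<close> also divides
      \<open>f\<close>, the cofactor \<open>Q\<close> annihilates x_v; for positive \<open>m\<close>
      its degree is below \<open>n\<close>, against the minimality of \<open>f\<close>.\<close>
    have "m = 0"
    proof (rule ccontr)
      assume m0: "m \<noteq> 0"
      have ev_e: "?ev e \<notin> p"
      proof
        assume ev: "?ev e \<in> p"
        have "P2 cg" unfolding P2_def using cg C1 polyfun_idealD(2)[OF ideal] by (intro conjI bexI[of _ 1]) auto
        then obtain k Q R where kQR: "smult (coeff e m ^ k) cg = Q * e + R" "Q \<in> ?C" "\<forall>i. coeff R i \<in> p"
          using rem[of cg "Suc (degree cg)"] by (auto simp: coeff_eq_0)
        have "?ev Q * ?ev e + ?ev R \<in> p"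
          using polyfun_idealD(3)[OF ideal polyfun_idealD(4)[OF ideal evU[OF kQR(2)] ev] poly_coord_in_ideal[OF ideal]] kQR(3) by blast
        then have "coeff e m ^ k * g \<in> p" using kQR(1) cg(2) by (metis poly_add poly_mult poly_smult)
        then have "coeff e m ^ k \<in> p \<or> g \<in> p"
          by (intro prime polyfun_power AU coeffs_inD[OF eC] polyfun_UNIV[OF g(1)])
        then show False using polyfun_prime_power[OF p AU[OF coeffs_inD[OF eC]] e(2)] g(2) by blast
      qed
      obtain k Q R where kQR: "smult (coeff e m ^ k) f = Q * e + R" "Q \<in> ?C" "R \<in> ?C" "\<forall>i. coeff R i \<in> p"
          "\<forall>i. Suc n \<le> i + m \<longrightarrow> coeff Q i = 0"
        using rem[OF \<open>P2 f\<close>, of "Suc n"] f(3) by (metis Suc_le_eq)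
      have kA: "coeff e m ^ k \<in> ?A" by (intro polyfun_power coeffs_inD[OF eC])
      have evR: "?ev R \<in> p" using poly_coord_in_ideal[OF ideal] kQR(4) by blast
      have "coeff e m ^ k * ?ev f - ?ev R \<in> p"
        by (intro polyfun_ideal_diff[OF ideal] polyfun_idealD(4)[OF ideal] AU kA fC evR)
      also have "coeff e m ^ k * ?ev f - ?ev R = ?ev Q * ?ev e"
        using kQR(1) by (metis add_diff_cancel_right' poly_add poly_mult poly_smult)
      finally have "?ev Q \<in> p" using prime[OF evU[OF kQR(2)] evU[OF eC]] ev_e by blast
      then have "P1 Q" using kQR(2) by (simp add: P1_def)
      then have Qp: "coeff Q i \<in> p" for i
        by (rule fmin) (use kQR(5) m0 polyfun_idealD(2)[OF ideal] in auto)
      have "coeff (Q * e + R) n \<in> p"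
        unfolding coeff_add coeff_mult using kQR(4)
        by (intro polyfun_idealD(3)[OF ideal] polyfun_ideal_sum[OF ideal] polyfun_idealD(5)[OF ideal] Qp AU coeffs_inD[OF eC]) auto
      then have "coeff e m ^ k * coeff f n \<in> p" using kQR(1) by (metis coeff_smult)
      then have "coeff e m ^ k \<in> p \<or> coeff f n \<in> p"
        by (intro prime AU kA coeffs_inD[OF fC(1)])
      then show False using polyfun_prime_power[OF p AU[OF coeffs_inD[OF eC]] e(2)] f(2) by blast
    qed
    define r where "r = coeff e 0"
    have "e = [:r:]" unfolding r_def
      using e(3) \<open>m = 0\<close> by (intro poly_eqI) (auto simp: coeff_pCons split: nat.split)
    then have ev_e: "?ev e = r" by (metis mult_zero_right poly_0 poly_pCons add.right_neutral)
    have r: "r \<in> ?A" "r \<notin> p" using e(2) \<open>m = 0\<close> coeffs_inD[OF eC] by (auto simp: r_def)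
    let ?l = "coeff f n"
    have l: "?l \<in> ?A" using coeffs_inD[OF fC(1)] .
    show ?thesis
    \<comment> \<open>Where \<open>?l\<close> is nonzero, \<open>f\<close> keeps a positive degree
      at \<open>a\<close> and so has a root \<open>t\<close>. Where \<open>r\<close> is nonzero, the
      congruence of \<open>r\<close> with a multiple of \<open>g\<close> modulo \<open>p\<close>
      forces \<open>g\<close> to be nonzero at the extended point.\<close>
    proof (intro bexI[of _ "?l * r"] conjI allI impI)
      show "?l * r \<notin> p" using prime[OF AU[OF l] AU[OF r(1)]] f(2) r(2) by blast
      show "?l * r \<in> ?A" using l r by (simp add: polyfun.mult)
      fix a :: "'v \<Rightarrow> 'a"
      assume "(\<forall>q\<in>p \<inter> ?A. q a = 0) \<and> (?l * r) a \<noteq> 0"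
      then have a: "\<And>q. q \<in> p \<Longrightarrow> q \<in> ?A \<Longrightarrow> q a = 0" and la: "?l a \<noteq> 0" and ra: "r a \<noteq> 0"
        by (auto simp: fun_arith_apply)
      let ?f = "map_poly (\<lambda>f. f a) f"
      have "coeff ?f n \<noteq> 0" using la by (simp add: coeff_map_poly zero_fun_apply)
      then have "degree ?f > 0" using le_degree[of ?f n] n0 by simp
      then obtain t where "poly ?f t = 0" using alg_closed_imp_poly_has_root by blast
      then have ft: "?ev f (a(v := t)) = 0" using polyfun_insert_update[OF fC(1) v] by simp
      have upd: "h (a(v := t)) = h a" if "h \<in> ?A" for h
        using v by (intro polyfun_cong[OF that]) auto
      \<comment> \<open>Modulo \<open>f\<close>, the element \<open>q\<close> leaves a remainder
        that satisfies \<open>P1\<close> in degree below \<open>n\<close>; its coefficients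
        therefore lie in \<open>p\<close> and vanish at \<open>a\<close>.\<close>
      have zero: "q (a(v := t)) = 0" if q: "q \<in> p" "q \<in> polyfun (insert v V)" for q
      proof -
        obtain c where c: "c \<in> ?C" "q = ?ev c" using q unfolding polyfun_insert by blast
        obtain k Q R where kQR: "smult (?l ^ k) c = Q * f + R" "\<forall>i. coeff Q i \<in> ?A" "\<forall>i. coeff R i \<in> ?A"
            "\<forall>i\<ge>n. coeff R i = 0"
          using pseudo_division[of ?A f n c "Suc (degree c)", OF A _ f(3)] coeffs_inD[OF fC(1)] coeffs_inD[OF c(1)]
          by (metis Suc_le_eq coeff_eq_0)
        have QR: "Q \<in> ?C" "R \<in> ?C" using kQR by (auto simp: coeffs_in_def)
        have "?l ^ k * q - ?ev Q * ?ev f \<in> p"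
          by (intro polyfun_ideal_diff[OF ideal] polyfun_idealD(4)[OF ideal] AU polyfun_power evU QR fC l q)
        also have eq: "?l ^ k * q = ?ev Q * ?ev f + ?ev R"
          using kQR(1) c(2) by (metis poly_add poly_mult poly_smult)
        finally have "P1 R" unfolding P1_def using QR by simp
        then have "coeff R i \<in> p" for i
          by (rule fmin) (use kQR(4) polyfun_idealD(2)[OF ideal] in auto)
        then have "?ev R (a(v := t)) = 0"
          using a kQR(3) QR v by (intro poly_coord_vanishes[of _ _ V]) auto
        then have "(?l ^ k * q) (a(v := t)) = 0" unfolding eq by (simp add: ft fun_arith_apply)
        then show ?thesis using la by (simp add: fun_arith_apply power_fun_apply upd[OF l])
      qed
      have "(?ev e - ?ev u * g) (a(v := t)) = 0"
        by (rule zero[OF u(2)])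
          (intro polyfun_diff polyfun.mult poly_coord_in_polyfun eC u(1) g(1))
      then have "r a = ?ev u (a(v := t)) * g (a(v := t))"
        using upd[OF r(1)] by (simp add: ev_e fun_arith_apply)
      then have "g (a(v := t)) \<noteq> 0" using ra by auto
      then show "\<exists>t. (\<forall>q\<in>p \<inter> polyfun (insert v V). q (a(v := t)) = 0) \<and> g (a(v := t)) \<noteq> 0"
        using zero by blast
    qed
  qed
qed

subsection \<open>Algebraic sets and prime ideals\<close>

lemma eval_mpoly_superset:
  assumes "finite K" "Poly_Mapping.keys p \<subseteq> K"
  shows "eval_mpoly p a = (\<Sum>m\<in>K. Poly_Mapping.lookup p m * (\<Prod>v\<in>UNIV. a v ^ Poly_Mapping.lookup m v))"
  unfolding eval_mpoly_def
  by (rule sum.mono_neutral_left) (use assms in \<open>auto simp: in_keys_iff\<close>)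

lemma eval_mpoly_add: "eval_mpoly (p + q) a = eval_mpoly p a + eval_mpoly q a"
proof -
  have K: "finite (Poly_Mapping.keys p \<union> Poly_Mapping.keys q)" by simp
  show ?thesis
    by (subst (1 2 3) eval_mpoly_superset[OF K])
      (auto simp: lookup_add ring_distribs sum.distrib dest!: subsetD[OF Poly_Mapping.keys_add])
qed

lemma eval_mpoly_single:
  "eval_mpoly (Poly_Mapping.single m c) a = c * (\<Prod>v\<in>UNIV. a v ^ Poly_Mapping.lookup m v)"
  by (subst eval_mpoly_superset[of "{m}"]) auto

lemma prod_power_single:
  fixes a :: "'v::finite \<Rightarrow> 'a::comm_semiring_1"
  shows "(\<Prod>u\<in>UNIV. a u ^ Poly_Mapping.lookup (Poly_Mapping.single v 1) u) = a v"
  by (subst prod.remove[of _ v]) (auto simp: lookup_single when_def intro!: prod.neutral)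

text \<open>The bridge between the formal polynomials and \<open>polyfun\<close>. Closure of the
  range under products follows by expanding into single terms, whose exponents add.\<close>

lemma range_eval_mpoly:
  "range (eval_mpoly :: ('v::finite, 'a::comm_ring_1) mpolynomial \<Rightarrow> _) = polyfun UNIV"
proof (intro equalityI subsetI)
  fix f :: "('v \<Rightarrow> 'a) \<Rightarrow> 'a" assume "f \<in> range eval_mpoly"
  then obtain p where "f = eval_mpoly p" by blast
  also have "eval_mpoly p = (\<Sum>m\<in>Poly_Mapping.keys p. (\<lambda>_. Poly_Mapping.lookup p m) *
      (\<Prod>v\<in>UNIV. (\<lambda>a. a v) ^ Poly_Mapping.lookup m v))"
    by (auto simp: fun_eq_iff eval_mpoly_def sum_fun_apply prod_fun_apply power_fun_apply fun_arith_apply)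
  also have "\<dots> \<in> polyfun UNIV"
    by (intro polyfun_sum polyfun.mult polyfun_prod polyfun_power polyfun.const polyfun.var UNIV_I)
  finally show "f \<in> polyfun UNIV" .
next
  let ?R = "range (eval_mpoly :: ('v, 'a) mpolynomial \<Rightarrow> _)"
  have add: "f + g \<in> ?R" if fg: "f \<in> ?R" "g \<in> ?R" for f g
  proof -
    obtain p q where "f = eval_mpoly p" "g = eval_mpoly q" using fg by blast
    then have "f + g = eval_mpoly (p + q)" by (auto simp: fun_eq_iff eval_mpoly_add fun_arith_apply)
    then show ?thesis by blast
  qed
  have "(0 :: ('v \<Rightarrow> 'a) \<Rightarrow> 'a) = eval_mpoly 0" by (auto simp: fun_eq_iff eval_mpoly_def zero_fun_apply)
  then have zero: "0 \<in> ?R" by blast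
  have sum: "(\<Sum>i\<in>A. f i) \<in> ?R" if "\<And>i. i \<in> A \<Longrightarrow> f i \<in> ?R" for A and f :: "'i \<Rightarrow> _"
    using that by (induction A rule: infinite_finite_induct) (simp_all add: add zero)
  have decomp: "eval_mpoly p = (\<Sum>m\<in>Poly_Mapping.keys p. eval_mpoly (Poly_Mapping.single m (Poly_Mapping.lookup p m)))"
    for p :: "('v, 'a) mpolynomial"
    by (auto simp: fun_eq_iff sum_fun_apply eval_mpoly_single) (simp add: eval_mpoly_def)
  fix f :: "('v \<Rightarrow> 'a) \<Rightarrow> 'a" assume "f \<in> polyfun UNIV"
  then show "f \<in> ?R"
  proof induction
    case (const c)
    have "(\<lambda>_. c) = eval_mpoly (Poly_Mapping.single 0 c :: ('v, 'a) mpolynomial)"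
      by (auto simp: fun_eq_iff eval_mpoly_single)
    then show ?case by blast
  next
    case (var v)
    have "(\<lambda>a. a v) = eval_mpoly (Poly_Mapping.single (Poly_Mapping.single v 1) 1 :: ('v, 'a) mpolynomial)"
      by (simp only: fun_eq_iff eval_mpoly_single prod_power_single mult_1 simp_thms)
    then show ?case by blast
  next
    case (add f g)
    show ?case by (rule \<open>f \<in> ?R \<Longrightarrow> g \<in> ?R \<Longrightarrow> f + g \<in> ?R\<close>) fact+
  next
    case (mult f g)
    then obtain p q where pq: "f = eval_mpoly p" "g = eval_mpoly q" by blast
    have single: "eval_mpoly (Poly_Mapping.single m c) * eval_mpoly (Poly_Mapping.single m' c') =
        (eval_mpoly (Poly_Mapping.single (m + m') (c * c')) :: ('v \<Rightarrow> 'a) \<Rightarrow> 'a)" for m m' c c'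
      by (auto simp: fun_eq_iff fun_arith_apply eval_mpoly_single lookup_add power_add prod.distrib)
    have "f * g = (\<Sum>m\<in>Poly_Mapping.keys p. \<Sum>m'\<in>Poly_Mapping.keys q.
        eval_mpoly (Poly_Mapping.single (m + m') (Poly_Mapping.lookup p m * Poly_Mapping.lookup q m')))"
      unfolding pq by (subst (1 2) decomp) (simp add: sum_product single)
    also have "\<dots> \<in> ?R" by (intro sum rangeI)
    finally show ?case .
  qed
qed

section \<open>Zero sets of polynomial functions and the Nullstellensatz for primes\<close>

definition zeros :: "(('v \<Rightarrow> 'a::comm_ring_1) \<Rightarrow> 'a) set \<Rightarrow> ('v \<Rightarrow> 'a) set" where
  "zeros F = {a. \<forall>f\<in>F. f a = 0}"

lemma zero_locus_eq_zeros: "zero_locus F = zeros (eval_mpoly ` F)"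
  by (auto simp: zero_locus_def zeros_def)

lemma algebraic_set_iff:
  "algebraic_set (S :: ('v::finite \<Rightarrow> 'a::comm_ring_1) set) \<longleftrightarrow> (\<exists>F\<subseteq>polyfun UNIV. S = zeros F)"
  unfolding algebraic_set_def zero_locus_eq_zeros
  by (metis range_eval_mpoly subset_image_iff subset_UNIV)

text \<open>On the line through \<open>a\<close> and \<open>b\<close> both functions become nonzero
  univariate polynomials, and their product has a nonroot. The point is given explicitly because it
  keeps every coordinate in which \<open>a\<close> and \<open>b\<close> agree.\<close>

lemma polyfun_common_nonzero:
  fixes f g :: "('v \<Rightarrow> 'a::alg_closed_field) \<Rightarrow> 'a"
  assumes "f \<in> polyfun V" "g \<in> polyfun W" "f a \<noteq> 0" "g b \<noteq> 0"
  shows "\<exists>t. f (\<lambda>v. a v + t * (b v - a v)) \<noteq> 0 \<and> g (\<lambda>v. a v + t * (b v - a v)) \<noteq> 0"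
proof -
  obtain q where q: "\<And>t. f (\<lambda>v. a v + t * (b v - a v)) = poly q t"
    using polyfun_restrict_line[OF assms(1), of a "\<lambda>v. b v - a v"] by blast
  obtain r where r: "\<And>t. g (\<lambda>v. a v + t * (b v - a v)) = poly r t"
    using polyfun_restrict_line[OF assms(2), of a "\<lambda>v. b v - a v"] by blast
  have "q \<noteq> 0" "r \<noteq> 0" using q[of 0] r[of 1] assms(3,4) by auto
  then obtain t where "poly (q * r) t \<noteq> 0" using poly_nonroot_exists[of "q * r"] by auto
  then show ?thesis using q r by auto
qed

lemma polyfun_mult_nonzero:
  fixes f g :: "('v \<Rightarrow> 'a::alg_closed_field) \<Rightarrow> 'a"
  assumes "f \<in> polyfun V" "g \<in> polyfun W" "f \<noteq> 0" "g \<noteq> 0"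
  shows "f * g \<noteq> 0"
proof -
  obtain a b where ab: "f a \<noteq> 0" "g b \<noteq> 0" using assms(3,4) by (auto simp: fun_eq_iff zero_fun_apply)
  obtain t where "f (\<lambda>v. a v + t * (b v - a v)) \<noteq> 0" "g (\<lambda>v. a v + t * (b v - a v)) \<noteq> 0"
    using polyfun_common_nonzero[of f V g W a b] assms(1,2) ab by blast
  then have "(f * g) (\<lambda>v. a v + t * (b v - a v)) \<noteq> 0" by (simp add: times_fun_apply)
  then show ?thesis by (metis zero_fun_apply)
qed

text \<open>The coordinates in \<open>D\<close> are added one at a time. The function
  \<open>g\<close> carries the induction: what must not vanish for the last extension becomes the
  \<open>g\<close> of the extension before it.\<close>

lemma extend_zero:
  fixes p :: "(('v \<Rightarrow> 'a::alg_closed_field) \<Rightarrow> 'a) set"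
  assumes p: "polyfun_prime p" and "finite D" "D \<inter> U = {}" "g \<in> polyfun (U \<union> D)" "g \<notin> p"
  shows "\<exists>g'\<in>polyfun U. g' \<notin> p \<and> (\<forall>a. (\<forall>q\<in>p \<inter> polyfun U. q a = 0) \<and> g' a \<noteq> 0 \<longrightarrow>
    (\<exists>b. (\<forall>u\<in>U. b u = a u) \<and> (\<forall>q\<in>p \<inter> polyfun (U \<union> D). q b = 0) \<and> g b \<noteq> 0))"
  using assms(2-)
proof (induction D arbitrary: g rule: finite_induct)
  case empty
  then show ?case by auto
next
  case (insert v D)
  have "v \<notin> U \<union> D" "g \<in> polyfun (insert v (U \<union> D))" using insert by auto
  from extend_zero_one_coordinate[OF p this \<open>g \<notin> p\<close>] obtain h where
    h: "h \<in> polyfun (U \<union> D)" "h \<notin> p" "\<And>a. (\<forall>q\<in>p \<inter> polyfun (U \<union> D). q a = 0) \<Longrightarrow> h a \<noteq> 0 \<Longrightarrow>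
      (\<exists>t. (\<forall>q\<in>p \<inter> polyfun (insert v (U \<union> D)). q (a(v := t)) = 0) \<and> g (a(v := t)) \<noteq> 0)" by blast
  have "D \<inter> U = {}" using insert by auto
  from insert.IH[OF this h(1,2)] obtain g' where g': "g' \<in> polyfun U" "g' \<notin> p"
    "\<And>a. (\<forall>q\<in>p \<inter> polyfun U. q a = 0) \<Longrightarrow> g' a \<noteq> 0 \<Longrightarrow>
      (\<exists>b. (\<forall>u\<in>U. b u = a u) \<and> (\<forall>q\<in>p \<inter> polyfun (U \<union> D). q b = 0) \<and> h b \<noteq> 0)" by blast
  show ?case
  proof (intro bexI[of _ g'] conjI allI impI)
    fix a assume "(\<forall>q\<in>p \<inter> polyfun U. q a = 0) \<and> g' a \<noteq> 0"
    with g'(3) obtain b where b: "\<forall>u\<in>U. b u = a u" "\<forall>q\<in>p \<inter> polyfun (U \<union> D). q b = 0" "h b \<noteq> 0" by blast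
    from h(3)[OF b(2,3)] obtain t where
      "(\<forall>q\<in>p \<inter> polyfun (insert v (U \<union> D)). q (b(v := t)) = 0) \<and> g (b(v := t)) \<noteq> 0" by blast
    moreover have "\<forall>u\<in>U. (b(v := t)) u = a u" using b(1) insert.prems(1) by auto
    ultimately show "\<exists>b. (\<forall>u\<in>U. b u = a u) \<and> (\<forall>q\<in>p \<inter> polyfun (U \<union> insert v D). q b = 0) \<and> g b \<noteq> 0"
      by (metis Un_insert_right)
  qed (use g' in auto)
qed

text \<open>Nullstellensatz for a prime: a proper ideal contains no constant but 0, so any point
  will do over the empty set of coordinates, and it is extended to all of them.\<close>

lemma prime_nonzero:
  fixes p :: "(('v::finite \<Rightarrow> 'a::alg_closed_field) \<Rightarrow> 'a) set"
  assumes p: "polyfun_prime p" and g: "g \<in> polyfun UNIV" "g \<notin> p"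
  shows "\<exists>b\<in>zeros p. g b \<noteq> 0"
proof -
  from extend_zero[of p UNIV "{}" g] assms obtain g' where g': "g' \<in> polyfun {}" "g' \<notin> p"
    "\<And>a. (\<forall>q\<in>p \<inter> polyfun {}. q a = 0) \<Longrightarrow> g' a \<noteq> 0 \<Longrightarrow>
      (\<exists>b. (\<forall>q\<in>p \<inter> polyfun UNIV. q b = 0) \<and> g b \<noteq> 0)" by auto
  have "q a = 0" if q: "q \<in> p" "q \<in> polyfun {}" for q a
  proof (rule ccontr)
    assume nz: "q a \<noteq> 0"
    obtain c where c: "q = (\<lambda>_. c)" using polyfun_empty[OF q(2)] by blast
    have "(\<lambda>_. inverse c) * q \<in> p"
      by (rule polyfun_idealD(4)[OF polyfun_primeD(1)[OF p] polyfun.const q(1)])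
    also have "(\<lambda>_. inverse c) * q = 1" using nz by (auto simp: fun_eq_iff c fun_arith_apply)
    finally show False using polyfun_primeD(2)[OF p] by contradiction
  qed
  moreover obtain a where "g' a \<noteq> 0"
    using g'(2) polyfun_idealD(2)[OF polyfun_primeD(1)[OF p]] by (metis ext zero_fun_apply)
  ultimately obtain b where b: "\<forall>q\<in>p \<inter> polyfun UNIV. q b = 0" "g b \<noteq> 0" using g'(3) by blast
  then show ?thesis using polyfun_idealD(1)[OF polyfun_primeD(1)[OF p]] unfolding zeros_def by blast
qed

text \<open>If neither part were everything, some \<open>f\<close> and \<open>g\<close> outside
  \<open>p\<close> would vanish on one part each. Their product is outside \<open>p\<close> as well,
  hence nonzero somewhere on \<open>zeros p\<close>.\<close>

lemma irreducible_zeros_prime: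
  fixes p :: "(('v::finite \<Rightarrow> 'a::alg_closed_field) \<Rightarrow> 'a) set"
  assumes p: "polyfun_prime p"
  shows "irreducible_algebraic_set (zeros p)"
  unfolding irreducible_algebraic_set_def
proof (intro conjI allI impI)
  show "algebraic_set (zeros p)"
    unfolding algebraic_set_iff using polyfun_idealD(1)[OF polyfun_primeD(1)[OF p]] by blast
  show "zeros p \<noteq> {}" using prime_nonzero[OF p polyfun_1 polyfun_primeD(2)[OF p]] by blast
  fix A B :: "('v \<Rightarrow> 'a) set" assume AB: "algebraic_set A \<and> algebraic_set B \<and> zeros p = A \<union> B"
  obtain F G where F: "F \<subseteq> polyfun UNIV" "A = zeros F" and G: "G \<subseteq> polyfun UNIV" "B = zeros G"
    using AB unfolding algebraic_set_iff by blast
  show "A = zeros p \<or> B = zeros p"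
  proof (rule ccontr)
    assume "\<not> ?thesis"
    then obtain a b where "a \<in> zeros p" "a \<notin> A" "b \<in> zeros p" "b \<notin> B" using AB by blast
    then obtain f g where fg: "f \<in> F" "f \<notin> p" "g \<in> G" "g \<notin> p"
      unfolding F G by (auto simp: zeros_def)
    then have "f \<in> polyfun UNIV" "g \<in> polyfun UNIV" using F G by auto
    then have "f * g \<in> polyfun UNIV" "f * g \<notin> p" using polyfun_primeD(3)[OF p] fg by (blast intro: polyfun.mult)+
    then obtain c where "c \<in> zeros p" "(f * g) c \<noteq> 0" using prime_nonzero[OF p] by blast
    moreover from this have "c \<in> A \<or> c \<in> B" using AB by blast
    ultimately show False using fg unfolding F G by (auto simp: zeros_def fun_arith_apply)
  qed
qed

section \<open>Prime ideals disjoint from a multiplicative set\<close>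

lemma polyfun_ideal_adjoin:
  fixes f :: "('v \<Rightarrow> 'a::comm_ring_1) \<Rightarrow> 'a"
  assumes I: "polyfun_ideal I" and f: "f \<in> polyfun UNIV"
  shows "polyfun_ideal {q + r * f |q r. q \<in> I \<and> r \<in> polyfun UNIV}" (is "polyfun_ideal ?J")
    and "I \<subseteq> {q + r * f |q r. q \<in> I \<and> r \<in> polyfun UNIV}"
    and "f \<in> {q + r * f |q r. q \<in> I \<and> r \<in> polyfun UNIV}"
proof -
  note I' = polyfun_idealD[OF I]
  show sub: "I \<subseteq> ?J"
  proof
    fix x assume "x \<in> I"
    then show "x \<in> ?J"
      by (intro CollectI exI[of _ x] exI[of _ 0]) (simp add: polyfun_0)
  qed
  show "f \<in> ?J"
    by (intro CollectI exI[of _ 0] exI[of _ 1]) (simp add: polyfun_1 I'(2))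
  show "polyfun_ideal ?J"
    unfolding polyfun_ideal_def
  proof (intro conjI ballI)
    show "?J \<subseteq> polyfun UNIV" using I'(1) f by (blast intro: polyfun.intros)
    show "0 \<in> ?J" using sub I'(2) by blast
  next
    fix x y assume "x \<in> ?J" "y \<in> ?J"
    then obtain q r q' r' where *: "x = q + r * f" "y = q' + r' * f" "q \<in> I" "q' \<in> I"
      "r \<in> polyfun UNIV" "r' \<in> polyfun UNIV" by blast
    then have "x + y = (q + q') + (r + r') * f" "q + q' \<in> I" "r + r' \<in> polyfun UNIV"
      by (simp_all add: I'(3) polyfun.add algebra_simps)
    then show "x + y \<in> ?J" by blast
  next
    fix x y :: "('v \<Rightarrow> 'a) \<Rightarrow> 'a" assume x: "x \<in> polyfun UNIV" and "y \<in> ?J"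
    then obtain q r where *: "y = q + r * f" "q \<in> I" "r \<in> polyfun UNIV" by blast
    have "x * q \<in> I" "x * r \<in> polyfun UNIV" by (rule I'(4) polyfun.mult, fact+)+
    moreover have "x * y = x * q + (x * r) * f" using * by (simp add: algebra_simps)
    ultimately show "x * y \<in> ?J" by blast
  qed
qed

text \<open>By Zorn's lemma there is an ideal maximal among those that contain \<open>I\<close> and
  avoid \<open>S\<close>. It is prime: adjoining \<open>f\<close> or \<open>g\<close> outside it
  would meet \<open>S\<close>, and the product of the two elements met would lie in both the ideal
  and \<open>S\<close> if \<open>f * g\<close> were in the ideal.\<close>

lemma polyfun_prime_avoiding:
  fixes I :: "(('v \<Rightarrow> 'a::comm_ring_1) \<Rightarrow> 'a) set"
  assumes I: "polyfun_ideal I" and S: "1 \<in> S" "\<And>f g. f \<in> S \<Longrightarrow> g \<in> S \<Longrightarrow> f * g \<in> S" and disj: "I \<inter> S = {}"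
  shows "\<exists>p. polyfun_prime p \<and> I \<subseteq> p \<and> p \<inter> S = {}"
proof -
  define J where "J = {p. polyfun_ideal p \<and> I \<subseteq> p \<and> p \<inter> S = {}}"
  have "\<exists>M\<in>J. \<forall>X\<in>J. M \<subseteq> X \<longrightarrow> X = M"
  proof (rule subset_Zorn_nonempty)
    show "J \<noteq> {}" using I disj by (auto simp: J_def)
    fix C assume C: "C \<noteq> {}" "subset.chain J C"
    then have CJ: "\<And>p. p \<in> C \<Longrightarrow> polyfun_ideal p \<and> I \<subseteq> p \<and> p \<inter> S = {}"
      and tot: "\<And>p q. p \<in> C \<Longrightarrow> q \<in> C \<Longrightarrow> p \<subseteq> q \<or> q \<subseteq> p"
      by (auto simp: subset_chain_def J_def)
    have "polyfun_ideal (\<Union>C)"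
      unfolding polyfun_ideal_def
    proof (intro conjI ballI)
      show "\<Union>C \<subseteq> polyfun UNIV" using CJ by (blast dest: polyfun_idealD)
      show "0 \<in> \<Union>C" using C(1) CJ by (blast dest: polyfun_idealD)
      show "f + g \<in> \<Union>C" if fg: "f \<in> \<Union>C" "g \<in> \<Union>C" for f g
      proof -
        obtain p q where "p \<in> C" "f \<in> p" "q \<in> C" "g \<in> q" using fg by blast
        then obtain r where "r \<in> C" "f \<in> r" "g \<in> r" using tot by blast
        then show ?thesis using CJ polyfun_idealD(3) by blast
      qed
      show "f * g \<in> \<Union>C" if "f \<in> polyfun UNIV" "g \<in> \<Union>C" for f g
        using that CJ polyfun_idealD(4) by blast
    qed
    moreover have "I \<subseteq> \<Union>C" "\<Union>C \<inter> S = {}" using C(1) CJ by blast+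
    ultimately show "\<Union>C \<in> J" by (simp add: J_def)
  qed
  then obtain p where p: "polyfun_ideal p" "I \<subseteq> p" "p \<inter> S = {}" and
    max: "\<And>q. polyfun_ideal q \<Longrightarrow> I \<subseteq> q \<Longrightarrow> q \<inter> S = {} \<Longrightarrow> p \<subseteq> q \<Longrightarrow> q = p"
    by (auto simp: J_def)
  have meet: "\<exists>q r. q \<in> p \<and> r \<in> polyfun UNIV \<and> q + r * f \<in> S" if f: "f \<in> polyfun UNIV" "f \<notin> p" for f
  proof (rule ccontr)
    assume "\<not> ?thesis"
    then have "{q + r * f |q r. q \<in> p \<and> r \<in> polyfun UNIV} \<inter> S = {}" by blast
    with polyfun_ideal_adjoin[OF p(1) f(1)] max p(2) f(2) show False by blast
  qed
  have "polyfun_prime p"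
    unfolding polyfun_prime_def
  proof (intro conjI ballI impI)
    fix f g assume f: "f \<in> polyfun UNIV" and g: "g \<in> polyfun UNIV" and fg: "f * g \<in> p"
    show "f \<in> p \<or> g \<in> p"
    proof (rule ccontr)
      assume "\<not> ?thesis"
      then obtain q r q' r' where *: "q \<in> p" "r \<in> polyfun UNIV" "q + r * f \<in> S"
        "q' \<in> p" "r' \<in> polyfun UNIV" "q' + r' * g \<in> S" using meet f g by metis
      have "q \<in> polyfun UNIV" using *(1) polyfun_idealD(1)[OF p(1)] by blast
      have 1: "q + r * f \<in> polyfun UNIV" "r' * g \<in> polyfun UNIV" "r * r' \<in> polyfun UNIV"
        by (rule polyfun.add[OF \<open>q \<in> polyfun UNIV\<close> polyfun.mult[OF *(2) f]]
          polyfun.mult[OF *(5) g] polyfun.mult[OF *(2,5)])+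
      have "(q + r * f) * q' + ((r' * g) * q + (r * r') * (f * g)) \<in> p"
        by (rule polyfun_idealD(3)[OF p(1)] 1[THEN polyfun_idealD(4)[OF p(1)]] * fg)+
      also have "(q + r * f) * q' + ((r' * g) * q + (r * r') * (f * g)) = (q + r * f) * (q' + r' * g)"
        by (simp add: algebra_simps)
      finally show False using S(2) * p(3) by blast
    qed
  qed (use p S in auto)
  then show ?thesis using p by blast
qed

text \<open>The coordinates in V are algebraically independent modulo \<open>p\<close>. A generic
  hyperplane section x_v = c gives a larger prime modulo which the remaining coordinates stay
  independent; \<open>zeros p\<close> is put on top of the chain obtained for that prime.\<close>

lemma chain_below_prime:
  fixes p :: "(('v::finite \<Rightarrow> 'a::alg_closed_field) \<Rightarrow> 'a) set"
  assumes "polyfun_prime p" "p \<inter> polyfun V = {0}"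
  shows "\<exists>Z. (\<forall>i\<le>card V. irreducible_algebraic_set (Z i) \<and> Z i \<subseteq> zeros p) \<and>
    (\<forall>i<card V. Z i \<subset> Z (Suc i))"
  using finite[of V] assms
proof (induction V arbitrary: p rule: finite_induct)
  case empty
  then show ?case by (intro exI[of _ "\<lambda>_. zeros p"]) (auto simp: irreducible_zeros_prime)
next
  case (insert v V)
  note p = insert.prems(1)
  note ideal = polyfun_primeD(1)[OF p]
  let ?U = "insert v V"
  have "(1 :: ('v \<Rightarrow> 'a) \<Rightarrow> 'a) \<in> polyfun (?U \<union> (UNIV - ?U))" "(UNIV - ?U) \<inter> ?U = {}"
    by (rule polyfun_1) blast
  from extend_zero[OF p finite this(2,1) polyfun_primeD(2)[OF p]] obtain g where
    g: "g \<in> polyfun ?U" and g': "g \<notin> p \<and> (\<forall>a. (\<forall>q\<in>p \<inter> polyfun ?U. q a = 0) \<and> g a \<noteq> 0 \<longrightarrow>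
      (\<exists>b. (\<forall>u\<in>?U. b u = a u) \<and> (\<forall>q\<in>p \<inter> polyfun (?U \<union> (UNIV - ?U)). q b = 0) \<and> (1 b :: 'a) \<noteq> 0))"
    by (rule bexE)
  have "?U \<union> (UNIV - ?U) = UNIV" by blast
  then have pU: "p \<inter> polyfun (?U \<union> (UNIV - ?U)) = p" using polyfun_idealD(1)[OF ideal] by auto
  \<comment> \<open>\<open>zeros p\<close> projects dominantly to the coordinates in
    \<open>?U\<close>: no nonzero element of \<open>p\<close> constrains them, so every point with
    \<open>g\<close> nonzero lifts.\<close>
  have ext: "\<exists>b\<in>zeros p. \<forall>u\<in>?U. b u = a u" if a: "g a \<noteq> 0" for a
  proof -
    have "\<forall>q\<in>p \<inter> polyfun ?U. q a = 0" using insert.prems(2) by (auto simp: zero_fun_apply)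
    from conjunct2[OF g'[unfolded pU], THEN spec, THEN mp, OF conjI[OF this a]]
    obtain b where "(\<forall>u\<in>?U. b u = a u) \<and> (\<forall>q\<in>p. q b = 0) \<and> (1 b :: 'a) \<noteq> 0" by (rule exE)
    then show ?thesis unfolding zeros_def by (intro bexI[of _ b]) simp_all
  qed
  have "g \<noteq> 0" using g' polyfun_idealD(2)[OF ideal] by blast
  then obtain a0 where a0: "g a0 \<noteq> 0" by (auto simp: fun_eq_iff zero_fun_apply)
  \<comment> \<open>The constant \<open>a0 v\<close> is generic in the sense that \<open>g\<close>
    does not vanish identically on the hyperplane x_v = \<open>a0 v\<close>.\<close>
  define l :: "('v \<Rightarrow> 'a) \<Rightarrow> 'a" where "l = (\<lambda>a. a v) - (\<lambda>_. a0 v)"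
  have l: "l \<in> polyfun ?U" unfolding l_def by (intro polyfun_diff polyfun.var polyfun.const) simp
  note lU = polyfun_UNIV[OF l]
  let ?I = "{q + r * l |q r. q \<in> p \<and> r \<in> polyfun UNIV}"
  let ?S = "polyfun V - {0} :: (('v \<Rightarrow> 'a) \<Rightarrow> 'a) set"
  \<comment> \<open>The points \<open>a0\<close> and \<open>a1(v := a0 v)\<close> lie on the
    hyperplane, hence so does the line through them. A point of it where \<open>g\<close> and
    \<open>h\<close> are nonzero lifts to a zero of \<open>p\<close> at which \<open>l\<close>, and
    with it \<open>h = q + r * l\<close>, vanishes.\<close>
  have "?I \<inter> ?S = {}"
  proof (rule equals0I)
    fix h assume "h \<in> ?I \<inter> ?S"
    then obtain q r where h: "h \<in> polyfun V" "h \<noteq> 0" "h = q + r * l" "q \<in> p" by blast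
    then obtain a1 where "h a1 \<noteq> 0" by (auto simp: fun_eq_iff zero_fun_apply)
    also have "h a1 = h (a1(v := a0 v))" using insert.hyps by (intro polyfun_cong[OF h(1)]) auto
    finally obtain t where t: "g (\<lambda>u. a0 u + t * ((a1(v := a0 v)) u - a0 u)) \<noteq> 0"
        "h (\<lambda>u. a0 u + t * ((a1(v := a0 v)) u - a0 u)) \<noteq> 0" (is "h ?b \<noteq> 0")
      using polyfun_common_nonzero[of g ?U h V a0 "a1(v := a0 v)"] g h(1) a0 by blast
    obtain b where b: "b \<in> zeros p" "\<forall>u\<in>?U. b u = ?b u" using ext[OF t(1)] by blast
    have "h b = h ?b" using b(2) by (intro polyfun_cong[OF h(1)]) auto
    moreover have "h b = 0" using b h by (auto simp: zeros_def fun_arith_apply l_def)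
    ultimately show False using t(2) by simp
  qed
  moreover have "1 \<in> ?S" by (simp add: polyfun_1)
  moreover have "f * g \<in> ?S" if "f \<in> ?S" "g \<in> ?S" for f g
    using that polyfun_mult_nonzero[of f V g V] polyfun.mult[of f V g] by blast
  ultimately obtain p' where p': "polyfun_prime p'" "?I \<subseteq> p'" "p' \<inter> ?S = {}"
    using polyfun_prime_avoiding[OF polyfun_ideal_adjoin(1)[OF ideal lU], of ?S] by blast
  have "p' \<inter> polyfun V = {0}" using p'(3) polyfun_idealD(2)[OF polyfun_primeD(1)[OF p'(1)]] polyfun_0[of V] by blast
  from insert.IH[OF p'(1) this] obtain Z where
    Z: "\<And>i. i \<le> card V \<Longrightarrow> irreducible_algebraic_set (Z i) \<and> Z i \<subseteq> zeros p'"
      "\<And>i. i < card V \<Longrightarrow> Z i \<subset> Z (Suc i)" by blast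
  have "p \<subseteq> p'" "l \<in> p'" using p'(2) polyfun_ideal_adjoin(2,3)[OF ideal lU] by blast+
  moreover have "l \<notin> p"
  proof
    assume "l \<in> p"
    then have "l = 0" using l insert.prems(2) by blast
    then have "l (\<lambda>_. a0 v + 1) = 0" by (simp add: zero_fun_apply)
    then show False by (simp add: l_def fun_arith_apply)
  qed
  ultimately have sub: "zeros p' \<subset> zeros p" using prime_nonzero[OF p lU] unfolding zeros_def by blast
  have card: "card ?U = Suc (card V)" using insert.hyps by simp
  show ?case
  proof (intro exI[of _ "\<lambda>i. if i \<le> card V then Z i else zeros p"] conjI allI impI)
    fix i assume "i \<le> card ?U"
    show "irreducible_algebraic_set (if i \<le> card V then Z i else zeros p)"
      using Z(1) irreducible_zeros_prime[OF p] by auto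
    show "(if i \<le> card V then Z i else zeros p) \<subseteq> zeros p" using Z(1) sub by auto
  next
    fix i assume "i < card ?U"
    then show "(if i \<le> card V then Z i else zeros p) \<subset> (if Suc i \<le> card V then Z (Suc i) else zeros p)"
    proof (cases "i < card V")
      case False
      then have "i = card V" using \<open>i < card ?U\<close> card by simp
      moreover have "Z (card V) \<subset> zeros p" using Z(1)[of "card V"] sub by blast
      ultimately show ?thesis by simp
    qed (use Z(2) in simp)
  qed
qed

subsection \<open>Forms and monomials\<close>

definition scale_fun :: "'a::field \<Rightarrow> ('b \<Rightarrow> 'a) \<Rightarrow> 'b \<Rightarrow> 'a" where
  "scale_fun c f = (\<lambda>_. c) * f"

lemma scale_fun_apply: "scale_fun c f a = c * f a"
  by (simp add: scale_fun_def fun_arith_apply)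

global_interpretation fun_vs: vector_space "scale_fun :: 'a::field \<Rightarrow> ('b \<Rightarrow> 'a) \<Rightarrow> 'b \<Rightarrow> 'a"
  by unfold_locales (auto simp: fun_eq_iff scale_fun_apply fun_arith_apply algebra_simps)

lemma fun_vs_span_mult:
  assumes "f \<in> fun_vs.span A" "g \<in> fun_vs.span B"
    and AB: "\<And>a b. a \<in> A \<Longrightarrow> b \<in> B \<Longrightarrow> a * b \<in> fun_vs.span C"
  shows "f * g \<in> fun_vs.span C"
proof -
  have scale: "scale_fun c x * y = scale_fun c (x * y)" for c and x y :: "'a \<Rightarrow> 'b"
    by (simp add: scale_fun_def mult.assoc)
  have b: "a * g \<in> fun_vs.span C" if a: "a \<in> A" for a
    using assms(2)
  proof (induction rule: fun_vs.span_induct_alt)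
    case base
    then show ?case by (simp add: fun_vs.span_zero)
  next
    case (step c x y)
    have "a * (scale_fun c x + y) = scale_fun c (a * x) + a * y"
      using scale[of c x a] by (simp add: algebra_simps)
    then show ?case using step AB[OF a] by (simp add: fun_vs.span_add fun_vs.span_scale)
  qed
  show ?thesis using assms(1)
  proof (induction rule: fun_vs.span_induct_alt)
    case base
    then show ?case by (simp add: fun_vs.span_zero)
  next
    case (step c x y)
    have "(scale_fun c x + y) * g = scale_fun c (x * g) + y * g"
      using scale[of c x g] by (simp add: algebra_simps)
    then show ?case using step b by (simp add: fun_vs.span_add fun_vs.span_scale)
  qed
qed

section \<open>Monomials, homogeneous forms and the degree filtration\<close>

definition mon :: "('v::finite \<Rightarrow> nat) \<Rightarrow> ('v \<Rightarrow> 'a::comm_ring_1) \<Rightarrow> 'a" where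
  "mon m = (\<lambda>a. \<Prod>v\<in>UNIV. a v ^ m v)"

definition mdeg :: "('v::finite \<Rightarrow> nat) \<Rightarrow> nat" where
  "mdeg m = (\<Sum>v\<in>UNIV. m v)"

definition forms :: "nat \<Rightarrow> (('v::finite \<Rightarrow> 'a::field) \<Rightarrow> 'a) set" where
  "forms e = fun_vs.span {mon m |m. mdeg m = e}"

definition forms_upto :: "nat \<Rightarrow> (('v::finite \<Rightarrow> 'a::field) \<Rightarrow> 'a) set" where
  "forms_upto e = fun_vs.span {mon m |m. mdeg m \<le> e}"

lemma mon_mult: "mon m * mon k = mon (m + k)"
  by (auto simp: fun_eq_iff mon_def fun_arith_apply power_add prod.distrib)

lemma mdeg_add: "mdeg (m + k) = mdeg m + mdeg k"
  by (simp add: mdeg_def sum.distrib plus_fun_apply)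

lemma mon_0: "mon 0 = 1"
  by (auto simp: fun_eq_iff mon_def fun_arith_apply)

lemma mdeg_0: "mdeg 0 = 0"
  by (simp add: mdeg_def zero_fun_apply)

lemma mon_var: "mon (\<lambda>u. if u = v then 1 else 0) = (\<lambda>a. a v)"
proof -
  have "(\<Prod>u\<in>UNIV. a u ^ (if u = v then 1 else 0)) = a v" for a :: "'a \<Rightarrow> 'b"
    by (subst prod.remove[of _ v]) (auto intro!: prod.neutral)
  then show ?thesis by (simp add: mon_def)
qed

lemma mdeg_var: "mdeg (\<lambda>u. if u = v then 1 else 0) = 1"
  by (simp add: mdeg_def)

lemma mon_in_forms: "mdeg m = e \<Longrightarrow> mon m \<in> forms e"
  unfolding forms_def by (rule fun_vs.span_base) blast

lemma forms_mult:
  assumes "f \<in> forms d" "g \<in> forms e" shows "f * g \<in> forms (d + e)"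
  using assms unfolding forms_def
proof (rule fun_vs_span_mult)
  fix a b :: "('a \<Rightarrow> 'b) \<Rightarrow> 'b"
  assume "a \<in> {mon m |m. mdeg m = d}" "b \<in> {mon m |m. mdeg m = e}"
  then obtain m k where "a = mon m" "b = mon k" "mdeg (m + k) = d + e" by (auto simp: mdeg_add)
  then show "a * b \<in> fun_vs.span {mon m |m. mdeg m = d + e}"
    by (intro fun_vs.span_base) (auto simp: mon_mult)
qed

lemma forms_upto_mult:
  assumes "f \<in> forms_upto d" "g \<in> forms_upto e" shows "f * g \<in> forms_upto (d + e)"
  using assms unfolding forms_upto_def
proof (rule fun_vs_span_mult)
  fix a b :: "('a \<Rightarrow> 'b) \<Rightarrow> 'b"
  assume "a \<in> {mon m |m. mdeg m \<le> d}" "b \<in> {mon m |m. mdeg m \<le> e}"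
  then obtain m k where "a = mon m" "b = mon k" "mdeg (m + k) \<le> d + e" by (fastforce simp: mdeg_add)
  then show "a * b \<in> fun_vs.span {mon m |m. mdeg m \<le> d + e}"
    by (intro fun_vs.span_base) (auto simp: mon_mult)
qed

lemma mon_in_forms_upto: "mdeg m \<le> e \<Longrightarrow> mon m \<in> forms_upto e"
  unfolding forms_upto_def by (rule fun_vs.span_base) blast

lemma forms_upto_prod:
  assumes "finite A" "\<And>i. i \<in> A \<Longrightarrow> f i \<in> forms_upto (k i)"
  shows "(\<Prod>i\<in>A. f i) \<in> forms_upto (\<Sum>i\<in>A. k i)"
  using assms
proof (induction A rule: finite_induct)
  case empty
  show ?case using mon_in_forms_upto[of 0 0] by (simp add: mon_0 mdeg_0)
next
  case (insert i A)
  then show ?case by (simp add: forms_upto_mult)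
qed

lemma const_eq_scale: "(\<lambda>_. c) = scale_fun c (mon 0)"
  by (auto simp: fun_eq_iff scale_fun_apply mon_0 one_fun_apply)

lemma forms_homogeneous:
  assumes "f \<in> forms e" shows "f (\<lambda>v. t * a v) = t ^ e * f a"
  using assms unfolding forms_def
proof (induction rule: fun_vs.span_induct_alt)
  case (step c x y)
  then obtain m where "x = mon m" "mdeg m = e" by blast
  then have "x (\<lambda>v. t * a v) = t ^ e * x a"
    by (auto simp: mon_def mdeg_def power_mult_distrib prod.distrib power_sum)
  then show ?case using step by (simp add: fun_arith_apply scale_fun_apply algebra_simps)
qed (simp add: zero_fun_apply)

lemma polyfun_span_mon:
  assumes "f \<in> polyfun UNIV" shows "f \<in> fun_vs.span (range mon)"
  using assms
proof induction
  case (const c)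
  show ?case unfolding const_eq_scale by (intro fun_vs.span_scale fun_vs.span_base) simp
next
  case (var v)
  show ?case unfolding mon_var[symmetric] by (intro fun_vs.span_base) simp
next
  case (add f g)
  then show ?case by (intro fun_vs.span_add)
next
  case (mult f g)
  show ?case
    by (rule fun_vs_span_mult[OF mult.IH]) (auto simp: mon_mult intro: fun_vs.span_base)
qed

lemma polyfun_decompose:
  assumes "f \<in> polyfun UNIV"
  shows "\<exists>n F. (\<forall>e. F e \<in> forms e) \<and> (\<forall>e>n. F e = 0) \<and> f = (\<Sum>e\<le>n. F e)"
  using polyfun_span_mon[OF assms]
proof (induction rule: fun_vs.span_induct_alt)
  case base
  show ?case by (intro exI[of _ 0] exI[of _ "\<lambda>_. 0"]) (auto simp: forms_def fun_vs.span_zero)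
next
  case (step c x y)
  then obtain m n F where x: "x = mon m" and F: "\<And>e. F e \<in> forms e" "\<And>e. e > n \<Longrightarrow> F e = 0" "y = (\<Sum>e\<le>n. F e)"
    by blast
  let ?F = "\<lambda>e. (if e = mdeg m then scale_fun c x else 0) + F e"
  let ?n = "n + mdeg m"
  have "y = (\<Sum>e\<le>?n. F e)"
    unfolding F(3) by (rule sum.mono_neutral_left) (auto simp: F(2))
  moreover have "(\<Sum>e\<le>?n. (if e = mdeg m then scale_fun c x else 0)) = scale_fun c x" by simp
  ultimately have "scale_fun c x + y = (\<Sum>e\<le>?n. ?F e)" unfolding sum.distrib by simp
  moreover have "\<forall>e. ?F e \<in> forms e"
    using F(1) unfolding x forms_def
    by (auto intro!: fun_vs.span_add fun_vs.span_scale simp: fun_vs.span_zero)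
      (auto intro: fun_vs.span_base)
  moreover have "\<forall>e>?n. ?F e = 0" using F(2) by auto
  ultimately show ?case by (intro exI[of _ ?n] exI[of _ ?F] conjI)
qed

text \<open>A polynomial in \<open>t\<close> that vanishes on an infinite field is 0. Applied to
  points scaled by \<open>t\<close>, this separates homogeneous components.\<close>

lemma power_sum_zero_imp_coeffs_zero:
  fixes c :: "nat \<Rightarrow> 'a::alg_closed_field"
  assumes "\<And>t. (\<Sum>e\<le>n. t ^ e * c e) = 0" "e \<le> n"
  shows "c e = 0"
proof -
  define q where "q = (\<Sum>e\<le>n. monom (c e) e)"
  have "poly q t = 0" for t using assms(1)[of t] by (simp add: q_def poly_sum poly_monom mult.commute)
  then have "q = 0" using poly_nonroot_exists by blast
  then have "coeff q e = 0" by simp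
  moreover have "coeff q e = c e" using assms(2) by (simp add: q_def coeff_sum)
  ultimately show ?thesis by simp
qed

lemma forms_explicit:
  assumes "f \<in> forms e"
  shows "\<exists>M c. finite M \<and> (\<forall>m\<in>M. mdeg m = e) \<and> f = (\<Sum>m\<in>M. scale_fun (c m) (mon m))"
  using assms unfolding forms_def
proof (induction rule: fun_vs.span_induct_alt)
  case base
  show ?case by (intro exI[of _ "{}"]) auto
next
  case (step b x y)
  then obtain m M c where x: "x = mon m" "mdeg m = e" and
    M: "finite M" "\<forall>m\<in>M. mdeg m = e" "y = (\<Sum>m\<in>M. scale_fun (c m) (mon m))" by blast
  let ?c = "\<lambda>k. (if k = m then b else 0) + (if k \<in> M then c k else 0)"
  have "(\<Sum>k\<in>insert m M. scale_fun (?c k) (mon k)) =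
      (\<Sum>k\<in>insert m M. if k = m then scale_fun b (mon k) else 0) + (\<Sum>k\<in>insert m M. if k \<in> M then scale_fun (c k) (mon k) else 0)"
    unfolding sum.distrib[symmetric] by (rule sum.cong) (auto simp: fun_vs.scale_left_distrib)
  also have "(\<Sum>k\<in>insert m M. if k = m then scale_fun b (mon k) else 0) = scale_fun b x"
    using M(1) by (simp add: x sum.delta)
  also have "(\<Sum>k\<in>insert m M. if k \<in> M then scale_fun (c k) (mon k) else 0) = y"
    unfolding M(3) by (rule sum.mono_neutral_cong_right) (use M(1) in auto)
  finally show ?case using M x(2) by (intro exI[of _ "insert m M"] exI[of _ ?c]) auto
qed

text \<open>Reindexes the components of a cofactor by the degree that they reach after
  multiplication with a form of degree \<open>d\<close>.\<close>

lemma sum_shift: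
  fixes F :: "nat \<Rightarrow> 'b::comm_monoid_add"
  assumes "\<And>k. k > n \<Longrightarrow> F k = 0" "d \<le> D"
  shows "(\<Sum>e\<le>n + D. if d \<le> e then F (e - d) else 0) = (\<Sum>k\<le>n. F k)"
proof -
  have "(\<Sum>k\<le>n. F k) = (\<Sum>e\<in>(+) d ` {..n}. F (e - d))"
    by (subst sum.reindex) auto
  also have "\<dots> = (\<Sum>e\<le>n + D. if d \<le> e then F (e - d) else 0)"
  proof (rule sum.mono_neutral_cong_left)
    show "\<forall>i\<in>{..n + D} - (+) d ` {..n}. (if d \<le> i then F (i - d) else 0) = 0"
    proof
      fix i assume i: "i \<in> {..n + D} - (+) d ` {..n}"
      have "i - d > n" if "d \<le> i"
      proof (rule ccontr)
        assume "\<not> i - d > n"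
        then have "i = d + (i - d)" "i - d \<in> {..n}" using that by auto
        then show False using i by blast
      qed
      then show "(if d \<le> i then F (i - d) else 0) = 0" using assms(1) by auto
    qed
  qed (use assms(2) in auto)
  finally show ?thesis by simp
qed

text \<open>As the generators are homogeneous, the homogeneous components of an ideal element are in
  the ideal, and those of an element of F[V] are in F[V]; a nonzero component is chosen. The clause
  \<open>g' i = 0\<close> covers the degrees in which the subtraction \<open>e - dg i\<close>
  truncates.\<close>

lemma homogeneous_component_in_ideal:
  fixes f :: "nat \<Rightarrow> ('v::finite \<Rightarrow> 'a::alg_closed_field) \<Rightarrow> 'a"
  assumes f: "\<And>i. i < s \<Longrightarrow> f i \<in> forms (dg i)"
    and g: "\<And>i. i < s \<Longrightarrow> g i \<in> polyfun UNIV"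
    and h: "(\<Sum>i<s. g i * f i) \<in> polyfun V" "(\<Sum>i<s. g i * f i) \<noteq> 0"
  shows "\<exists>e M c g'. finite M \<and> M \<noteq> {} \<and> (\<forall>m\<in>M. c m \<noteq> 0 \<and> mdeg m = e \<and> (\<forall>v. v \<notin> V \<longrightarrow> m v = 0)) \<and>
    (\<forall>i<s. g' i \<in> forms (e - dg i) \<and> (e < dg i \<longrightarrow> g' i = 0)) \<and>
    (\<Sum>m\<in>M. scale_fun (c m) (mon m)) = (\<Sum>i<s. g' i * f i)"
proof -
  let ?h = "\<Sum>i<s. g i * f i"
  have "\<forall>i<s. \<exists>n F. (\<forall>e. F e \<in> forms e) \<and> (\<forall>e>n. F e = 0) \<and> g i = (\<Sum>e\<le>n. F e)"
    using polyfun_decompose g by blast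
  then obtain n G where G: "\<And>i e. i < s \<Longrightarrow> G i e \<in> forms e" "\<And>i e. i < s \<Longrightarrow> e > n i \<Longrightarrow> G i e = 0"
    "\<And>i. i < s \<Longrightarrow> g i = (\<Sum>e\<le>n i. G i e)" by metis
  define N where "N = (\<Sum>i<s. n i)"
  define D where "D = (\<Sum>i<s. dg i)"
  have N: "n i \<le> N" and D: "dg i \<le> D" if "i < s" for i
    unfolding N_def D_def using that by (auto intro: member_le_sum)
  define g' where "g' e i = (if dg i \<le> e then G i (e - dg i) else 0)" for e i
  define H where "H e = (\<Sum>i<s. g' e i * f i)" for e
  have g': "g' e i \<in> forms (e - dg i)" "e < dg i \<Longrightarrow> g' e i = 0" if "i < s" for e i
    using G(1)[OF that] by (auto simp: g'_def forms_def fun_vs.span_zero)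
  have Hf: "H e \<in> forms e" for e
    unfolding H_def forms_def
  proof (rule fun_vs.span_sum)
    fix i assume "i \<in> {..<s}"
    then have i: "i < s" by simp
    show "g' e i * f i \<in> fun_vs.span {mon m |m. mdeg m = e}"
    proof (cases "dg i \<le> e")
      case True
      then have "(e - dg i) + dg i = e" by simp
      then show ?thesis using forms_mult[OF g'(1)[OF i, of e] f[OF i]] by (simp add: forms_def)
    qed (simp add: g'_def fun_vs.span_zero)
  qed
  have "g i = (\<Sum>e\<le>N + D. g' e i)" if i: "i < s" for i
  proof -
    have "g i = (\<Sum>e\<le>N. G i e)"
      unfolding G(3)[OF i] by (rule sum.mono_neutral_left) (use N[OF i] G(2)[OF i] in auto)
    also have "\<dots> = (\<Sum>e\<le>N + D. g' e i)"
      unfolding g'_def by (rule sum_shift[symmetric]) (use N[OF i] D[OF i] G(2)[OF i] in auto)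
    finally show ?thesis .
  qed
  then have "?h = (\<Sum>i<s. \<Sum>e\<le>N + D. g' e i * f i)" by (simp add: sum_distrib_right)
  also have "\<dots> = (\<Sum>e\<le>N + D. H e)" unfolding H_def by (rule sum.swap)
  finally have hH: "?h = (\<Sum>e\<le>N + D. H e)" .
  \<comment> \<open>Setting the coordinates outside V to 0 does not change the whole sum. Comparing
    powers of \<open>t\<close> along scaled points shows that it does not change any component
    \<open>H e\<close> either.\<close>
  define \<sigma> where "\<sigma> a = (\<lambda>v. if v \<in> V then a v else 0)" for a :: "'v \<Rightarrow> 'a"
  have H\<sigma>: "H e (\<sigma> a) = H e a" if e: "e \<le> N + D" for e a
  proof -
    have "(\<Sum>e\<le>N + D. t ^ e * (H e (\<sigma> a) - H e a)) = 0" for t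
    proof -
      have "?h (\<lambda>v. t * \<sigma> a v) = ?h (\<lambda>v. t * a v)"
        by (rule polyfun_cong[OF h(1)]) (simp add: \<sigma>_def)
      then show ?thesis
        unfolding hH by (simp add: sum_fun_apply forms_homogeneous[OF Hf] right_diff_distrib sum_subtractf)
    qed
    from power_sum_zero_imp_coeffs_zero[OF this e] show ?thesis by simp
  qed
  obtain e where e: "e \<le> N + D" "H e \<noteq> 0"
    using h(2) unfolding hH by (metis (no_types, lifting) atMost_iff sum.neutral)
  obtain M c where M: "finite M" "\<forall>m\<in>M. mdeg m = e" "H e = (\<Sum>m\<in>M. scale_fun (c m) (mon m))"
    using forms_explicit[OF Hf] by blast
  \<comment> \<open>Under \<open>\<sigma>\<close> exactly the monomials that involve a variable
    outside V disappear, so \<open>M'\<close> still represents \<open>H e\<close>.\<close>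
  define M' where "M' = {m\<in>M. c m \<noteq> 0 \<and> (\<forall>v. v \<notin> V \<longrightarrow> m v = 0)}"
  have mon\<sigma>: "mon m (\<sigma> a) = (if \<forall>v. v \<notin> V \<longrightarrow> m v = 0 then mon m a else 0)" for m and a :: "'v \<Rightarrow> 'a"
  proof (cases "\<forall>v. v \<notin> V \<longrightarrow> m v = 0")
    case True
    then show ?thesis by (auto simp: mon_def \<sigma>_def intro!: prod.cong)
  next
    case False
    then obtain v where "v \<notin> V" "m v \<noteq> 0" by blast
    then have "mon m (\<sigma> a) = 0" unfolding mon_def by (intro prod_zero) (auto simp: \<sigma>_def)
    then show ?thesis using False by auto
  qed
  have "H e = (\<Sum>m\<in>M'. scale_fun (c m) (mon m))"
  proof (rule ext)
    fix a
    have "H e a = H e (\<sigma> a)" using H\<sigma>[OF e(1)] by simp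
    also have "\<dots> = (\<Sum>m\<in>M. c m * mon m (\<sigma> a))" by (simp add: M(3) sum_fun_apply scale_fun_apply)
    also have "\<dots> = (\<Sum>m\<in>M'. c m * mon m a)"
      unfolding mon\<sigma> M'_def by (rule sum.mono_neutral_cong_right) (use M(1) in auto)
    finally show "H e a = (\<Sum>m\<in>M'. scale_fun (c m) (mon m)) a" by (simp add: sum_fun_apply scale_fun_apply)
  qed
  moreover from this e(2) have "M' \<noteq> {}" by auto
  moreover have "finite M'" "\<forall>m\<in>M'. c m \<noteq> 0 \<and> mdeg m = e \<and> (\<forall>v. v \<notin> V \<longrightarrow> m v = 0)"
    using M by (auto simp: M'_def)
  ultimately show ?thesis
    using g' unfolding H_def
    by (intro exI[of _ e] exI[of _ M'] exI[of _ c] exI[of _ "g' e"]) simp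
qed

text \<open>The weights are powers of a base \<open>B\<close> larger than all exponents in S, so the
  weighted sum lists the exponents as digits. Being additive, it can serve as a monomial order:
  leading monomials are unique and survive multiplication by a monomial.\<close>

lemma separating_weight:
  fixes S :: "('v::finite \<Rightarrow> nat) set"
  assumes "finite S"
  shows "\<exists>w :: 'v \<Rightarrow> nat. inj_on (\<lambda>m. \<Sum>v\<in>UNIV. w v * m v) S"
proof -
  define B where "B = Suc (\<Sum>m\<in>S. \<Sum>v\<in>UNIV. m v)"
  have B: "m v < B" if "m \<in> S" for m v
  proof -
    have "m v \<le> (\<Sum>v\<in>UNIV. m v)" by (rule member_le_sum) auto
    also have "\<dots> \<le> (\<Sum>m\<in>S. \<Sum>v\<in>UNIV. m v)" by (rule member_le_sum[OF that]) (use assms in auto)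
    finally show ?thesis by (simp add: B_def)
  qed
  have "\<exists>w :: 'v \<Rightarrow> nat. \<forall>m\<in>S. \<forall>k\<in>S. (\<Sum>v\<in>A. w v * m v) = (\<Sum>v\<in>A. w v * k v) \<longrightarrow> (\<forall>v\<in>A. m v = k v)"
    for A :: "'v set"
    using finite[of A]
  proof (induction A rule: finite_induct)
    case empty
    then show ?case by auto
  next
    case (insert u A)
    then obtain w where w: "\<And>m k. m \<in> S \<Longrightarrow> k \<in> S \<Longrightarrow> (\<Sum>v\<in>A. w v * m v) = (\<Sum>v\<in>A. w v * k v) \<Longrightarrow> \<forall>v\<in>A. m v = k v"
      by blast
    let ?w = "\<lambda>v. if v = u then 1 else B * w v"
    have sum: "(\<Sum>v\<in>insert u A. ?w v * m v) = m u + B * (\<Sum>v\<in>A. w v * m v)" for m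
    proof -
      have "(\<Sum>v\<in>A. ?w v * m v) = B * (\<Sum>v\<in>A. w v * m v)"
        unfolding sum_distrib_left by (rule sum.cong) (use insert.hyps in auto)
      then show ?thesis using insert.hyps by simp
    qed
    show ?case
    proof (intro exI[of _ ?w] ballI impI)
      fix m k v assume mk: "m \<in> S" "k \<in> S" "v \<in> insert u A"
        and eq: "(\<Sum>v\<in>insert u A. ?w v * m v) = (\<Sum>v\<in>insert u A. ?w v * k v)"
      from eq have eq': "m u + B * (\<Sum>v\<in>A. w v * m v) = k u + B * (\<Sum>v\<in>A. w v * k v)" unfolding sum .
      then have "(m u + B * (\<Sum>v\<in>A. w v * m v)) mod B = (k u + B * (\<Sum>v\<in>A. w v * k v)) mod B" by simp
      then have u: "m u = k u" using B mk by simp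
      moreover have "B > 0" by (simp add: B_def)
      ultimately have "(\<Sum>v\<in>A. w v * m v) = (\<Sum>v\<in>A. w v * k v)" using eq' by simp
      from w[OF mk(1,2) this] u mk(3) show "m v = k v" by auto
    qed
  qed
  from this[of UNIV] obtain w :: "'v \<Rightarrow> nat" where
    w: "\<forall>m\<in>S. \<forall>k\<in>S. (\<Sum>v\<in>UNIV. w v * m v) = (\<Sum>v\<in>UNIV. w v * k v) \<longrightarrow> (\<forall>v\<in>UNIV. m v = k v)"
    by (rule exE)
  show ?thesis
  proof (intro exI[of _ w] inj_onI)
    fix m k assume "m \<in> S" "k \<in> S" "(\<Sum>v\<in>UNIV. w v * m v) = (\<Sum>v\<in>UNIV. w v * k v)"
    then show "m = k" using w by (intro HOL.ext) simp
  qed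
qed

text \<open>A lower bound for the dimension of the polynomials of bounded degree: the unnormalised
  Lagrange functions of the grid with sides \<open>P\<close> are independent, each being nonzero at
  its own grid point and 0 at all others.\<close>

lemma independent_grid_functions:
  fixes P :: "'a::field set"
  assumes "finite P"
  shows "\<exists>Q :: (('v::finite \<Rightarrow> 'a) \<Rightarrow> 'a) set. fun_vs.independent Q \<and> card Q = card P ^ CARD('v) \<and>
    Q \<subseteq> forms_upto (CARD('v) * (card P - 1))"
proof -
  define G where "G = (UNIV :: 'v set) \<rightarrow>\<^sub>E P"
  define \<delta> :: "('v \<Rightarrow> 'a) \<Rightarrow> ('v \<Rightarrow> 'a) \<Rightarrow> 'a"
    where "\<delta> p = (\<Prod>v\<in>UNIV. \<Prod>e\<in>P - {p v}. (\<lambda>a. a v) - (\<lambda>_. e))" for p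
  have ap: "\<delta> p a = (\<Prod>v\<in>UNIV. \<Prod>e\<in>P - {p v}. a v - e)" for p a
    by (simp add: \<delta>_def prod_fun_apply fun_arith_apply)
  have self: "\<delta> p p \<noteq> 0" for p using assms by (auto simp: ap)
  have other: "\<delta> p q = 0" if pq: "q \<in> G" "p \<noteq> q" for p q
  proof -
    obtain v where "p v \<noteq> q v" using pq(2) by blast
    then have "(\<Prod>e\<in>P - {p v}. q v - e) = 0"
      using pq(1) assms by (intro prod_zero) (auto simp: G_def)
    then show ?thesis unfolding ap by (intro prod_zero) auto
  qed
  have finG: "finite G" unfolding G_def using assms by (intro finite_PiE) auto
  have inj: "inj_on \<delta> G" using self other by (metis inj_onI)
  have ind: "fun_vs.independent (\<delta> ` G)"
  proof
    assume "fun_vs.dependent (\<delta> ` G)"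
    then have "\<exists>c. (\<exists>x\<in>\<delta> ` G. c x \<noteq> 0) \<and> (\<Sum>x\<in>\<delta> ` G. scale_fun (c x) x) = 0"
      by (subst (asm) fun_vs.dependent_finite) (use finG in simp_all)
    then obtain c where c: "(\<exists>x\<in>\<delta> ` G. c x \<noteq> 0) \<and> (\<Sum>x\<in>\<delta> ` G. scale_fun (c x) x) = 0"
      by (rule exE)
    then have sum: "(\<Sum>x\<in>\<delta> ` G. scale_fun (c x) x) = 0" by (rule conjunct2)
    from c obtain p where p: "p \<in> G" "c (\<delta> p) \<noteq> 0" by auto
    have "0 = (\<Sum>q\<in>G. scale_fun (c (\<delta> q)) (\<delta> q)) p"
      using sum by (simp add: sum.reindex[OF inj] zero_fun_apply)
    also have "\<dots> = (\<Sum>q\<in>G. if q = p then c (\<delta> q) * \<delta> q p else 0)"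
      unfolding sum_fun_apply scale_fun_apply by (rule sum.cong) (use other p in auto)
    also have "\<dots> = c (\<delta> p) * \<delta> p p" using finG p by simp
    finally show False using self[of p] p(2) by simp
  qed
  have "\<delta> p \<in> forms_upto (CARD('v) * (card P - 1))" if p: "p \<in> G" for p
  proof -
    have lin: "(\<lambda>a. a v) - (\<lambda>_. e) \<in> forms_upto 1" for v :: 'v and e :: 'a
    proof -
      have "mon (\<lambda>u. if u = v then 1 else 0) \<in> forms_upto 1" "mon 0 \<in> forms_upto 1"
        by (rule mon_in_forms_upto, simp only: mdeg_var mdeg_0 order_refl zero_le)+
      then show ?thesis
        unfolding mon_var[symmetric] const_eq_scale forms_upto_def
        by (intro fun_vs.span_diff fun_vs.span_scale)
    qed
    have "\<delta> p \<in> forms_upto (\<Sum>v\<in>(UNIV :: 'v set). \<Sum>e\<in>P - {p v}. 1)"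
      unfolding \<delta>_def by (intro forms_upto_prod lin) (use assms in auto)
    moreover have "(\<Sum>v\<in>(UNIV :: 'v set). \<Sum>e\<in>P - {p v}. 1) = CARD('v) * (card P - 1)"
    proof -
      have "card (P - {p v}) = card P - 1" for v
        using p by (intro card_Diff_singleton) (auto simp: G_def)
      then show ?thesis by simp
    qed
    ultimately show ?thesis by simp
  qed
  moreover have "card (\<delta> ` G) = card P ^ CARD('v)"
    by (simp add: card_image[OF inj]) (simp add: G_def card_PiE)
  ultimately show ?thesis using ind by blast
qed

subsection \<open>A coordinate subspace independent modulo an ideal of forms\<close>

definition fun_ideal :: "nat \<Rightarrow> (nat \<Rightarrow> ('v \<Rightarrow> 'a::comm_ring_1) \<Rightarrow> 'a) \<Rightarrow> (('v \<Rightarrow> 'a) \<Rightarrow> 'a) set" where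
  "fun_ideal s f = {\<Sum>i<s. g i * f i |g. \<forall>i<s. g i \<in> polyfun UNIV}"

text \<open>Division by the forms \<open>\<Sum>m\<in>M V. c V m \<cdot> mon m\<close>, which lie in the ideal of the \<open>f i\<close>, with respect to
  their leading monomials \<open>lm V\<close>: a monomial is reduced to standard monomials, with coefficients
  that are polynomials in the \<open>f i\<close>.\<close>

lemma mon_in_span_standard:
  fixes f :: "nat \<Rightarrow> ('v::finite \<Rightarrow> 'a::field) \<Rightarrow> 'a" and w :: "'v \<Rightarrow> nat"
  assumes dg: "\<And>i. i < s \<Longrightarrow> f i \<in> forms (dg i)" "\<And>i. i < s \<Longrightarrow> dg i \<ge> 1"
    and M: "\<And>V. V \<in> \<V> \<Longrightarrow> finite (M V)" "\<And>V m. V \<in> \<V> \<Longrightarrow> m \<in> M V \<Longrightarrow> mdeg m = e V"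
    and lm: "\<And>V. V \<in> \<V> \<Longrightarrow> lm V \<in> M V" "\<And>V. V \<in> \<V> \<Longrightarrow> c V (lm V) \<noteq> 0"
      "\<And>V m. V \<in> \<V> \<Longrightarrow> m \<in> M V \<Longrightarrow> m \<noteq> lm V \<Longrightarrow> (\<Sum>v\<in>UNIV. w v * m v) < (\<Sum>v\<in>UNIV. w v * lm V v)"
    and g: "\<And>V i. V \<in> \<V> \<Longrightarrow> i < s \<Longrightarrow> g V i \<in> forms (e V - dg i)"
      "\<And>V i. V \<in> \<V> \<Longrightarrow> i < s \<Longrightarrow> e V < dg i \<Longrightarrow> g V i = 0"
    and rep: "\<And>V. V \<in> \<V> \<Longrightarrow> (\<Sum>m\<in>M V. scale_fun (c V m) (mon m)) = (\<Sum>i<s. g V i * f i)"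
    and m: "mdeg m = D"
  shows "mon m \<in> fun_vs.span {mon m * (\<Prod>i<s. f i ^ \<alpha> i) |m \<alpha>. mdeg m \<le> D \<and> (\<forall>i. \<alpha> i \<le> D) \<and>
    (\<forall>V\<in>\<V>. \<not> (\<forall>v. lm V v \<le> m v))}"
proof -
  define Std where "Std D = {mon m * (\<Prod>i<s. f i ^ \<alpha> i) |m \<alpha>. mdeg m \<le> D \<and> (\<forall>i. \<alpha> i \<le> D) \<and>
    (\<forall>V\<in>\<V>. \<not> (\<forall>v. lm V v \<le> m v))}" for D
  \<comment> \<open>The outer induction is on the degree, the inner one on the weight. Replacing a
    leading monomial yields monomials of equal degree and smaller weight, and multiples of the
    \<open>f i\<close> with cofactors of smaller degree.\<close>
  have "\<forall>m. mdeg m = D \<longrightarrow> mon m \<in> fun_vs.span (Std D)"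
  proof (induction D rule: less_induct)
    case (less D)
    \<comment> \<open>A factor \<open>f i\<close> raises one exponent \<open>\<alpha> i\<close> by
      1, and \<open>D' < D\<close> leaves room for it; hence the exponents can be bounded by the
      degree.\<close>
    have times_f: "x * f i \<in> fun_vs.span (Std D)" if x: "x \<in> fun_vs.span (Std D')" and i: "i < s" and D': "D' < D" for x i D'
      using x
    proof (induction rule: fun_vs.span_induct_alt)
      case base
      show ?case by (simp add: fun_vs.span_zero)
    next
      case (step b x y)
      then obtain m \<alpha> where x: "x = mon m * (\<Prod>i<s. f i ^ \<alpha> i)" "mdeg m \<le> D'" "\<forall>i. \<alpha> i \<le> D'"
        "\<forall>V\<in>\<V>. \<not> (\<forall>v. lm V v \<le> m v)" unfolding Std_def by blast
      let ?\<alpha> = "\<alpha>(i := Suc (\<alpha> i))"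
      have "(\<Prod>j<s. f j ^ ?\<alpha> j) = f i ^ Suc (\<alpha> i) * (\<Prod>j\<in>{..<s} - {i}. f j ^ ?\<alpha> j)"
        by (subst prod.remove[of _ i]) (use i in auto)
      also have "(\<Prod>j\<in>{..<s} - {i}. f j ^ ?\<alpha> j) = (\<Prod>j\<in>{..<s} - {i}. f j ^ \<alpha> j)"
        by (rule prod.cong) auto
      also have "f i ^ Suc (\<alpha> i) * \<dots> = (f i ^ \<alpha> i * \<dots>) * f i" by (simp add: mult_ac)
      also have "f i ^ \<alpha> i * (\<Prod>j\<in>{..<s} - {i}. f j ^ \<alpha> j) = (\<Prod>j<s. f j ^ \<alpha> j)"
        by (subst (2) prod.remove[of _ i]) (use i in auto)
      finally have "x * f i = mon m * (\<Prod>j<s. f j ^ ?\<alpha> j)" by (simp add: x(1) mult.assoc)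
      moreover have "mdeg m \<le> D" "\<forall>j. ?\<alpha> j \<le> D" 
        using x(2,3) D' by (auto simp: Suc_le_eq intro: le_less_trans intro!: less_imp_le[OF le_less_trans[OF _ D']])
      ultimately have "x * f i \<in> Std D" unfolding Std_def using x(4) by blast
      moreover have "(scale_fun b x + y) * f i = scale_fun b (x * f i) + y * f i"
        by (simp add: scale_fun_def algebra_simps)
      ultimately show ?case using step.IH by (simp add: fun_vs.span_add fun_vs.span_scale fun_vs.span_base)
    qed
    have "mdeg m = D \<longrightarrow> mon m \<in> fun_vs.span (Std D)" for m
    proof (induction "\<Sum>v\<in>UNIV. w v * m v" arbitrary: m rule: less_induct)
      case weight: less
      show ?case
      proof
        assume m: "mdeg m = D"
        show "mon m \<in> fun_vs.span (Std D)"
        proof (cases "\<forall>V\<in>\<V>. \<not> (\<forall>v. lm V v \<le> m v)")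
          case True
          then have "mon m \<in> Std D"
            unfolding Std_def using m by (intro CollectI exI[of _ m] exI[of _ "\<lambda>_. 0"]) simp
          then show ?thesis by (rule fun_vs.span_base)
        next
          case False
          then obtain V where V: "V \<in> \<V>" "\<And>v. lm V v \<le> m v" by blast
          define k where "k = (\<lambda>v. m v - lm V v)"
          have mk: "m = lm V + k" using V(2) by (auto simp: k_def fun_eq_iff plus_fun_apply)
          have ek: "e V + mdeg k = D" using m M(2)[OF V(1) lm(1)[OF V(1)]] unfolding mk by (simp add: mdeg_add)
          have low: "mon (x + k) \<in> fun_vs.span (Std D)" if x: "x \<in> M V - {lm V}" for x
          proof (rule weight.hyps[THEN mp])
            have "(\<Sum>v\<in>UNIV. w v * x v) < (\<Sum>v\<in>UNIV. w v * lm V v)" using lm(3)[OF V(1)] x by blast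
            then show "(\<Sum>v\<in>UNIV. w v * (x + k) v) < (\<Sum>v\<in>UNIV. w v * m v)"
              unfolding mk by (simp add: plus_fun_apply distrib_left sum.distrib)
            show "mdeg (x + k) = D" using M(2)[OF V(1), of x] x ek by (simp add: mdeg_add)
          qed
          \<comment> \<open>The cofactor has degree \<open>D - dg i\<close>, which is below
            \<open>D\<close> because \<open>dg i\<close> is positive, so the outer induction applies
            to it.\<close>
          have high: "mon k * g V i * f i \<in> fun_vs.span (Std D)" if i: "i < s" for i
          proof (cases "e V < dg i")
            case True
            then show ?thesis using g(2)[OF V(1) i] by (simp add: fun_vs.span_zero)
          next
            case False
            define D' where "D' = D - dg i"
            have "D' < D" "mdeg k + (e V - dg i) = D'" using False dg(2)[OF i] ek by (auto simp: D'_def)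
            then have "mon k * g V i \<in> forms D'"
              using forms_mult[OF mon_in_forms[OF refl, of k] g(1)[OF V(1) i]] by simp
            also have "forms D' \<subseteq> fun_vs.span (Std D')"
              unfolding forms_def by (rule fun_vs.span_minimal) (use less.IH[OF \<open>D' < D\<close>] in auto)
            finally show ?thesis using times_f[OF _ i \<open>D' < D\<close>] by blast
          qed
          have "(\<Sum>x\<in>M V. scale_fun (c V x) (mon (x + k))) = mon k * (\<Sum>x\<in>M V. scale_fun (c V x) (mon x))"
            by (simp add: sum_distrib_left scale_fun_def mult_ac flip: mon_mult)
          also have "\<dots> = (\<Sum>i<s. mon k * g V i * f i)"
            unfolding rep[OF V(1)] by (simp add: sum_distrib_left mult.assoc)
          finally have "scale_fun (c V (lm V)) (mon m) + (\<Sum>x\<in>M V - {lm V}. scale_fun (c V x) (mon (x + k))) =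
              (\<Sum>i<s. mon k * g V i * f i)"
            unfolding mk by (subst (asm) sum.remove[OF M(1)[OF V(1)] lm(1)[OF V(1)]])
          then have "scale_fun (c V (lm V)) (mon m) = (\<Sum>i<s. mon k * g V i * f i) -
              (\<Sum>x\<in>M V - {lm V}. scale_fun (c V x) (mon (x + k)))" by (simp add: eq_diff_eq)
          also have "\<dots> \<in> fun_vs.span (Std D)"
            using low high by (intro fun_vs.span_diff fun_vs.span_sum fun_vs.span_scale) auto
          finally have "scale_fun (inverse (c V (lm V))) (scale_fun (c V (lm V)) (mon m)) \<in> fun_vs.span (Std D)"
            by (rule fun_vs.span_scale)
          then show ?thesis using lm(2)[OF V(1)] by simp
        qed
      qed
    qed
    then show ?case by blast
  qed
  then show ?thesis using m unfolding Std_def by blast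
qed

text \<open>There are at most \<open>2 ^ CARD('v)\<close> choices for the set T of places with
  exponent at least \<open>E\<close>. Each place in T allows \<open>D + 1\<close> exponents and each
  other place \<open>E\<close> of them, so for fixed \<open>E\<close> the growth in \<open>D\<close>
  has order at most \<open>d - 1\<close>.\<close>

lemma card_standard_exponents:
  fixes d E D :: nat
  assumes "E \<ge> 1" "d \<ge> 1"
  defines "S \<equiv> {m :: 'v::finite \<Rightarrow> nat. (\<forall>v. m v \<le> D) \<and> card {v. E \<le> m v} < d}"
  shows "finite S \<and> card S \<le> 2 ^ CARD('v) * (E ^ CARD('v) * (D + 1) ^ (d - 1))"
proof -
  define R where "R T = Pi\<^sub>E (UNIV :: 'v set) (\<lambda>v. if v \<in> T then {..D} else {..<E})" for T
  let ?T = "{T :: 'v set. card T < d}"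
  have sub: "S \<subseteq> (\<Union>T\<in>?T. R T)"
  proof
    fix m assume "m \<in> S"
    then have "m \<in> R {v. E \<le> m v}" "{v. E \<le> m v} \<in> ?T" by (auto simp: S_def R_def)
    then show "m \<in> (\<Union>T\<in>?T. R T)" by blast
  qed
  have fin: "finite (R T)" for T unfolding R_def by (intro finite_PiE) auto
  have card: "card (R T) \<le> E ^ CARD('v) * (D + 1) ^ (d - 1)" if T: "T \<in> ?T" for T
  proof -
    have "card (R T) = (\<Prod>v\<in>UNIV. if v \<in> T then D + 1 else E)"
      unfolding R_def by (subst card_PiE) (auto intro!: prod.cong)
    also have "\<dots> \<le> (\<Prod>v\<in>(UNIV :: 'v set). E * (if v \<in> T then D + 1 else 1))"
    proof (rule prod_mono)
      fix v
      have "D + 1 \<le> E * (D + 1)" using assms(1) by (metis mult_le_mono1 mult_1)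
      then show "0 \<le> (if v \<in> T then D + 1 else E) \<and>
          (if v \<in> T then D + 1 else E) \<le> E * (if v \<in> T then D + 1 else 1)" by auto
    qed
    also have "\<dots> = E ^ CARD('v) * (D + 1) ^ card T"
      by (simp add: prod.distrib prod.If_cases)
    also have "\<dots> \<le> E ^ CARD('v) * (D + 1) ^ (d - 1)"
      using T assms(2) by (intro mult_le_mono2 power_increasing) auto
    finally show ?thesis .
  qed
  have finT: "finite ?T" by simp
  have "card S \<le> card (\<Union>T\<in>?T. R T)" by (rule card_mono[OF _ sub]) (use fin in auto)
  also have "\<dots> \<le> (\<Sum>T\<in>?T. card (R T))" by (rule card_UN_le[OF finT])
  also have "\<dots> \<le> (\<Sum>T\<in>?T. E ^ CARD('v) * (D + 1) ^ (d - 1))" by (rule sum_mono) (rule card)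
  also have "\<dots> = card ?T * (E ^ CARD('v) * (D + 1) ^ (d - 1))" by simp
  also have "card ?T \<le> card (UNIV :: 'v set set)" by (rule card_mono) auto
  also have "card (UNIV :: 'v set set) = 2 ^ CARD('v)" by (simp add: card_UNIV_set)
  finally have "card S \<le> 2 ^ CARD('v) * (E ^ CARD('v) * (D + 1) ^ (d - 1))" by simp
  moreover have "finite S" by (rule finite_subset[OF sub]) (use fin in auto)
  ultimately show ?thesis by blast
qed

text \<open>In the proof, a monomial that no leading monomial \<open>lm V\<close> divides has fewer than \<open>CARD('v) - s\<close>
  exponents \<open>\<ge> E\<close>, since \<open>lm V\<close> only involves the variables in \<open>V\<close>; this bounds the number of standard
  monomials.\<close>

lemma exists_independent_coordinates:
  fixes f :: "nat \<Rightarrow> ('v::finite \<Rightarrow> 'a::alg_closed_field) \<Rightarrow> 'a"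
  assumes f: "\<And>i. i < s \<Longrightarrow> f i \<in> forms (dg i)" "\<And>i. i < s \<Longrightarrow> dg i \<ge> 1" and s: "s < CARD('v)"
  shows "\<exists>V. card V = CARD('v) - s \<and> fun_ideal s f \<inter> polyfun V = {0}"
proof (rule ccontr)
  assume contra: "\<not> ?thesis"
  define d where "d = CARD('v) - s"
  define \<V> where "\<V> = {V :: 'v set. card V = d}"
  have zero: "0 \<in> fun_ideal s f"
    unfolding fun_ideal_def by (intro CollectI exI[of _ "\<lambda>_. 0"]) (simp add: polyfun_0)
  have "\<forall>V\<in>\<V>. \<exists>e M c g. finite M \<and> M \<noteq> {} \<and> (\<forall>m\<in>M. c m \<noteq> 0 \<and> mdeg m = e \<and> (\<forall>v. v \<notin> V \<longrightarrow> m v = 0)) \<and>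
    (\<forall>i<s. g i \<in> forms (e - dg i) \<and> (e < dg i \<longrightarrow> g i = 0)) \<and>
    (\<Sum>m\<in>M. scale_fun (c m) (mon m)) = (\<Sum>i<s. g i * f i)"
  proof
    fix V assume "V \<in> \<V>"
    then have "fun_ideal s f \<inter> polyfun V \<noteq> {0}" using contra unfolding \<V>_def d_def by blast
    then obtain h where "h \<in> fun_ideal s f" "h \<in> polyfun V" "h \<noteq> 0" using zero polyfun_0[of V] by blast
    then obtain g where g: "\<forall>i<s. g i \<in> polyfun UNIV" "(\<Sum>i<s. g i * f i) \<in> polyfun V" "(\<Sum>i<s. g i * f i) \<noteq> 0"
      unfolding fun_ideal_def by blast
    show "\<exists>e M c g. finite M \<and> M \<noteq> {} \<and> (\<forall>m\<in>M. c m \<noteq> 0 \<and> mdeg m = e \<and> (\<forall>v. v \<notin> V \<longrightarrow> m v = 0)) \<and>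
      (\<forall>i<s. g i \<in> forms (e - dg i) \<and> (e < dg i \<longrightarrow> g i = 0)) \<and>
      (\<Sum>m\<in>M. scale_fun (c m) (mon m)) = (\<Sum>i<s. g i * f i)"
      by (rule homogeneous_component_in_ideal[OF f(1) _ g(2,3)]) (use g(1) in blast)+
  qed
  then obtain e M c g where *: "\<forall>V\<in>\<V>. finite (M V) \<and> M V \<noteq> {} \<and>
      (\<forall>m\<in>M V. c V m \<noteq> 0 \<and> mdeg m = e V \<and> (\<forall>v. v \<notin> V \<longrightarrow> m v = 0)) \<and>
      (\<forall>i<s. g V i \<in> forms (e V - dg i) \<and> (e V < dg i \<longrightarrow> g V i = 0)) \<and>
      (\<Sum>m\<in>M V. scale_fun (c V m) (mon m)) = (\<Sum>i<s. g V i * f i)"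
    unfolding bchoice_iff by blast
  \<comment> \<open>One weight is needed for all V together, since the division uses the forms of
    all V with respect to the same order.\<close>
  have "finite (\<Union>V\<in>\<V>. M V)" using * by (intro finite_UN_I) auto
  then obtain w :: "'v \<Rightarrow> nat" where w: "inj_on (\<lambda>m. \<Sum>v\<in>UNIV. w v * m v) (\<Union>V\<in>\<V>. M V)"
    using separating_weight by blast
  let ?w = "\<lambda>m. \<Sum>v\<in>UNIV. w v * m v"
  have "\<forall>V\<in>\<V>. \<exists>l. l \<in> M V \<and> (\<forall>m\<in>M V. m \<noteq> l \<longrightarrow> ?w m < ?w l)"
  proof
    fix V assume V: "V \<in> \<V>"
    have "finite (?w ` M V)" "?w ` M V \<noteq> {}" using * V by auto
    then have "Max (?w ` M V) \<in> ?w ` M V" by (rule Max_in)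
    then obtain l where l: "l \<in> M V" "?w l = Max (?w ` M V)" by force
    have "?w m < ?w l" if m: "m \<in> M V" "m \<noteq> l" for m
    proof -
      have "?w m \<le> ?w l" unfolding l(2) using \<open>finite (?w ` M V)\<close> m(1) by (intro Max_ge) auto
      moreover have "?w m \<noteq> ?w l" using inj_onD[OF w, of m l] m l(1) V by blast
      ultimately show ?thesis by simp
    qed
    then show "\<exists>l. l \<in> M V \<and> (\<forall>m\<in>M V. m \<noteq> l \<longrightarrow> ?w m < ?w l)" using l(1) by blast
  qed
  then obtain lm where lm: "\<forall>V\<in>\<V>. lm V \<in> M V \<and> (\<forall>m\<in>M V. m \<noteq> lm V \<longrightarrow> ?w m < ?w (lm V))"
    by (rule bchoice[THEN exE])
  define Std where "Std D = {mon m * (\<Prod>i<s. f i ^ \<alpha> i) |m \<alpha>. mdeg m \<le> D \<and> (\<forall>i. \<alpha> i \<le> D) \<and>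
    (\<forall>V\<in>\<V>. \<not> (\<forall>v. lm V v \<le> m v))}" for D
  have red: "mon m \<in> fun_vs.span (Std (mdeg m))" for m
    unfolding Std_def
    by (rule mon_in_span_standard[where M = M and e = e and c = c and g = g and dg = dg and w = w, OF f])
      (use * lm in auto)
  have Std_mono: "Std D \<subseteq> Std D'" if "D \<le> D'" for D D'
    unfolding Std_def using that by (blast intro: order.trans)
  have upto: "forms_upto D \<subseteq> fun_vs.span (Std D)" for D
    unfolding forms_upto_def
  proof (rule fun_vs.span_minimal)
    show "{mon m |m. mdeg m \<le> D} \<subseteq> fun_vs.span (Std D)"
      using red fun_vs.span_mono[OF Std_mono] by blast
  qed simp
  define E where "E = Suc (\<Sum>V\<in>\<V>. \<Sum>v\<in>UNIV. lm V v)"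
  have E: "lm V v < E" if "V \<in> \<V>" for V v
  proof -
    have "lm V v \<le> (\<Sum>v\<in>UNIV. lm V v)" by (rule member_le_sum) auto
    also have "\<dots> \<le> (\<Sum>V\<in>\<V>. \<Sum>v\<in>UNIV. lm V v)" by (rule member_le_sum[OF that]) auto
    finally show ?thesis by (simp add: E_def)
  qed
  have d: "d \<ge> 1" "(d - 1) + s = CARD('v) - 1" using s by (auto simp: d_def)
  \<comment> \<open>The exponents \<open>d - 1\<close> from the standard monomials and
    \<open>s\<close> from the powers of the \<open>f i\<close> add up to
    \<open>CARD('v) - 1\<close>, one less than the growth of the space of all polynomials of degree
    at most \<open>D\<close>.\<close>
  have cardStd: "finite (Std D) \<and> card (Std D) \<le> 2 ^ CARD('v) * E ^ CARD('v) * (D + 1) ^ (CARD('v) - 1)" for D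
  proof -
    define S where "S = {m :: 'v \<Rightarrow> nat. (\<forall>v. m v \<le> D) \<and> card {v. E \<le> m v} < d}"
    have S: "finite S" "card S \<le> 2 ^ CARD('v) * (E ^ CARD('v) * (D + 1) ^ (d - 1))"
      using card_standard_exponents[of E d D, where 'v = 'v] d(1) unfolding S_def by (auto simp: E_def)
    define A where "A = {..<s} \<rightarrow>\<^sub>E {..D}"
    have A: "finite A" "card A = (D + 1) ^ s" unfolding A_def by (auto intro: finite_PiE simp: card_PiE)
    have "Std D \<subseteq> (\<lambda>(m, \<alpha>). mon m * (\<Prod>i<s. f i ^ \<alpha> i)) ` (S \<times> A)"
    proof
      fix x assume "x \<in> Std D"
      then obtain m \<alpha> where x: "x = mon m * (\<Prod>i<s. f i ^ \<alpha> i)" "mdeg m \<le> D" "\<forall>i. \<alpha> i \<le> D"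
        and std: "\<forall>V\<in>\<V>. \<not> (\<forall>v. lm V v \<le> m v)" unfolding Std_def by blast
      have "m v \<le> D" for v
        using member_le_sum[of v UNIV m] x(2) by (simp add: mdeg_def)
      moreover have "card {v. E \<le> m v} < d"
      proof (rule ccontr)
        assume "\<not> ?thesis"
        then obtain V where V: "V \<subseteq> {v. E \<le> m v}" "card V = d"
          by (metis linorder_not_less obtain_subset_with_card_n)
        then have VV: "V \<in> \<V>" by (simp add: \<V>_def)
        have "lm V v \<le> m v" for v
        proof (cases "v \<in> V")
          case True
          then show ?thesis using E[OF VV, of v] V(1) by auto
        next
          case False
          then have "lm V v = 0" using * lm VV by blast
          then show ?thesis by simp
        qed
        then show False using std VV by blast
      qed
      ultimately have "m \<in> S" by (simp add: S_def)
      moreover have "restrict \<alpha> {..<s} \<in> A" using x(3) by (auto simp: A_def)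
      moreover have "x = mon m * (\<Prod>i<s. f i ^ restrict \<alpha> {..<s} i)" by (simp add: x(1))
      ultimately show "x \<in> (\<lambda>(m, \<alpha>). mon m * (\<Prod>i<s. f i ^ \<alpha> i)) ` (S \<times> A)"
        by (intro image_eqI[of _ _ "(m, restrict \<alpha> {..<s})"]) auto
    qed
    from finite_surj[OF _ this] surj_card_le[OF _ this] have "finite (Std D)" "card (Std D) \<le> card S * card A"
      using S(1) A(1) by (auto simp: card_cartesian_product)
    moreover have "card S * card A \<le> 2 ^ CARD('v) * (E ^ CARD('v) * (D + 1) ^ (d - 1)) * (D + 1) ^ s"
      unfolding A(2) using S(2) by (rule mult_le_mono1)
    moreover have "\<dots> = 2 ^ CARD('v) * E ^ CARD('v) * (D + 1) ^ (CARD('v) - 1)"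
      unfolding d(2)[symmetric] power_add by (simp only: mult.assoc)
    ultimately show ?thesis by (metis order.trans)
  qed
  define n where "n = CARD('v)"
  \<comment> \<open>Chosen so that for degree \<open>n * C\<close> the upper bound is at most
    \<open>C * Suc C ^ (n - 1)\<close>, below the \<open>Suc C ^ n\<close> independent functions on
    a grid with sides of size \<open>Suc C\<close>.\<close>
  define C where "C = 2 ^ n * E ^ n * n ^ (n - 1)"
  have n: "n \<ge> 1" using s by (simp add: n_def)
  obtain P :: "'a set" where P: "finite P" "card P = Suc C"
    using infinite_arbitrarily_large[OF infinite_UNIV_alg_closed] by blast
  obtain Q :: "(('v \<Rightarrow> 'a) \<Rightarrow> 'a) set" where Q: "fun_vs.independent Q" "card Q = Suc C ^ n" "Q \<subseteq> forms_upto (n * C)"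
    using independent_grid_functions[OF P(1), where 'v = 'v] unfolding P(2) n_def by auto
  have "Suc C ^ n \<le> card (Std (n * C))"
    using fun_vs.independent_span_bound[of "Std (n * C)" Q] Q upto[of "n * C"] cardStd[of "n * C"] by auto
  also have "\<dots> \<le> 2 ^ n * E ^ n * (n * C + 1) ^ (n - 1)" using cardStd[of "n * C"] by (simp add: n_def)
  also have "\<dots> \<le> 2 ^ n * E ^ n * (n * Suc C) ^ (n - 1)"
    using n by (intro mult_le_mono2 power_mono) auto
  also have "\<dots> = C * Suc C ^ (n - 1)" by (simp only: C_def power_mult_distrib mult.assoc)
  also have "\<dots> < Suc C * Suc C ^ (n - 1)" by simp
  also have "\<dots> = Suc C ^ n" using n by (simp add: power_eq_if)
  finally show False by simp
qed

subsection \<open>Ranks of tensors\<close>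

lemma polyfun_ideal_fun_ideal:
  fixes f :: "nat \<Rightarrow> ('v \<Rightarrow> 'a::comm_ring_1) \<Rightarrow> 'a"
  assumes f: "\<And>i. i < s \<Longrightarrow> f i \<in> polyfun UNIV"
  shows "polyfun_ideal (fun_ideal s f)"
  unfolding polyfun_ideal_def
proof (intro conjI ballI)
  show "fun_ideal s f \<subseteq> polyfun UNIV"
  proof
    fix h assume "h \<in> fun_ideal s f"
    then obtain g where g: "h = (\<Sum>i<s. g i * f i)" "\<forall>i<s. g i \<in> polyfun UNIV" unfolding fun_ideal_def by blast
    show "h \<in> polyfun UNIV"
      unfolding g(1) by (rule polyfun_sum, rule polyfun.mult) (use f g(2) in auto)
  qed
  show "0 \<in> fun_ideal s f"
    unfolding fun_ideal_def by (intro CollectI exI[of _ "\<lambda>_. 0"]) (simp add: polyfun_0)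
next
  fix x y assume "x \<in> fun_ideal s f" "y \<in> fun_ideal s f"
  then obtain g h where "x = (\<Sum>i<s. g i * f i)" "\<forall>i<s. g i \<in> polyfun UNIV"
    "y = (\<Sum>i<s. h i * f i)" "\<forall>i<s. h i \<in> polyfun UNIV" unfolding fun_ideal_def by blast
  then show "x + y \<in> fun_ideal s f"
    unfolding fun_ideal_def
    by (intro CollectI exI[of _ "\<lambda>i. g i + h i"]) (simp add: distrib_right sum.distrib polyfun.add)
next
  fix x y :: "('v \<Rightarrow> 'a) \<Rightarrow> 'a" assume x: "x \<in> polyfun UNIV" and "y \<in> fun_ideal s f"
  then obtain g where "y = (\<Sum>i<s. g i * f i)" "\<forall>i<s. g i \<in> polyfun UNIV" unfolding fun_ideal_def by blast
  then show "x * y \<in> fun_ideal s f"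
    unfolding fun_ideal_def using x
    by (intro CollectI exI[of _ "\<lambda>i. x * g i"]) (simp add: sum_distrib_left mult.assoc polyfun.mult)
qed

lemma generator_in_fun_ideal:
  assumes "i < s" shows "f i \<in> fun_ideal s f"
proof -
  have "(\<Sum>j<s. (if j = i then 1 else 0) * f j) = (\<Sum>j<s. if j = i then f j else 0)"
    by (rule sum.cong) auto
  also have "\<dots> = f i" using assms by simp
  finally show ?thesis
    unfolding fun_ideal_def
    by (intro CollectI exI[of _ "\<lambda>j. if j = i then 1 else 0"]) (simp add: polyfun_0 polyfun_1)
qed

lemma forms_polyfun:
  assumes "f \<in> forms e" shows "f \<in> polyfun UNIV"
proof -
  obtain M c where "f = (\<Sum>m\<in>M. scale_fun (c m) (mon m))" using forms_explicit[OF assms] by blast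
  also have "\<dots> = (\<Sum>m\<in>M. (\<lambda>_. c m) * (\<Prod>v\<in>UNIV. (\<lambda>a. a v) ^ m v))"
    by (rule sum.cong)
      (auto simp: fun_eq_iff scale_fun_def mon_def prod_fun_apply power_fun_apply fun_arith_apply)
  also have "\<dots> \<in> polyfun UNIV"
    by (intro polyfun_sum polyfun.mult polyfun_prod polyfun_power polyfun.const polyfun.var UNIV_I)
  finally show ?thesis .
qed

text \<open>The ideal of the forms avoids F[V] - {0} for some V with \<open>CARD('v) - s\<close>
  elements; a prime above it that still does so carries a chain of that length. Positive degrees
  exclude nonzero constants, whose zero set is empty.\<close>

lemma dim_zeros_forms_ge:
  fixes f :: "nat \<Rightarrow> ('v::finite \<Rightarrow> 'a::alg_closed_field) \<Rightarrow> 'a"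
  assumes f: "\<And>i. i < s \<Longrightarrow> f i \<in> forms (dg i)" "\<And>i. i < s \<Longrightarrow> dg i \<ge> 1" and s: "s < CARD('v)"
    and S: "zeros (f ` {..<s}) \<subseteq> S"
  shows "enat (CARD('v) - s) \<le> dim_alg S"
proof -
  obtain V where V: "card V = CARD('v) - s" "fun_ideal s f \<inter> polyfun V = {0}"
    using exists_independent_coordinates[of s f dg, OF f s] by blast
  have ideal: "polyfun_ideal (fun_ideal s f)" using polyfun_ideal_fun_ideal f forms_polyfun by blast
  let ?S = "polyfun V - {0} :: (('v \<Rightarrow> 'a) \<Rightarrow> 'a) set"
  have "1 \<in> ?S" by (simp add: polyfun_1)
  moreover have "f * g \<in> ?S" if "f \<in> ?S" "g \<in> ?S" for f g
    using that polyfun_mult_nonzero[of f V g V] polyfun.mult[of f V g] by blast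
  moreover have "fun_ideal s f \<inter> ?S = {}" using V(2) by blast
  ultimately obtain p where p: "polyfun_prime p" "fun_ideal s f \<subseteq> p" "p \<inter> ?S = {}"
    using polyfun_prime_avoiding[OF ideal, of ?S] by blast
  have "p \<inter> polyfun V = {0}"
    using p(3) polyfun_idealD(2)[OF polyfun_primeD(1)[OF p(1)]] polyfun_0[of V] by blast
  from chain_below_prime[OF p(1) this] obtain Z where
    Z: "\<forall>i\<le>card V. irreducible_algebraic_set (Z i) \<and> Z i \<subseteq> zeros p" "\<forall>i<card V. Z i \<subset> Z (Suc i)" by blast
  have "zeros p \<subseteq> zeros (f ` {..<s})"
    using p(2) generator_in_fun_ideal[of _ s f] by (auto simp: zeros_def)
  then have "\<forall>i\<le>card V. irreducible_algebraic_set (Z i) \<and> Z i \<subseteq> S" using Z(1) S by blast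
  then show ?thesis
    unfolding dim_alg_def V(1)[symmetric] using Z(2) by (intro Sup_upper) blast
qed

section \<open>Bihomogeneous polynomials, linear and bilinear forms\<close>

lemma bihomogeneous_forms:
  fixes p :: "('n1::finite + 'n2::finite, 'a::field) mpolynomial"
  assumes "bihomogeneous d e p" shows "eval_mpoly p \<in> forms (d + e)"
proof -
  have "eval_mpoly p = (\<Sum>m\<in>Poly_Mapping.keys p. scale_fun (Poly_Mapping.lookup p m) (mon (Poly_Mapping.lookup m)))"
    by (auto simp: fun_eq_iff eval_mpoly_def sum_fun_apply scale_fun_apply mon_def)
  moreover have "mdeg (Poly_Mapping.lookup m) = d + e" if "m \<in> Poly_Mapping.keys p" for m
  proof -
    have "mdeg (Poly_Mapping.lookup m) = (\<Sum>i\<in>UNIV. Poly_Mapping.lookup m (Inl i)) + (\<Sum>j\<in>UNIV. Poly_Mapping.lookup m (Inr j))"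
      unfolding mdeg_def UNIV_Plus_UNIV[symmetric] by (subst sum.Plus) (auto simp: o_def)
    then show ?thesis using assms that by (simp add: bihomogeneous_def)
  qed
  ultimately show ?thesis
    unfolding forms_def by (auto intro!: fun_vs.span_sum fun_vs.span_scale intro: fun_vs.span_base)
qed

lemma bihomogeneous_single:
  assumes "(\<Sum>i\<in>UNIV. Poly_Mapping.lookup m (Inl i)) = d" "(\<Sum>j\<in>UNIV. Poly_Mapping.lookup m (Inr j)) = e"
  shows "bihomogeneous d e (Poly_Mapping.single m c)"
  using assms by (auto simp: bihomogeneous_def)

lemma bihomogeneous_add:
  assumes "bihomogeneous d e p" "bihomogeneous d e q" shows "bihomogeneous d e (p + q)"
  unfolding bihomogeneous_def
proof
  fix m assume "m \<in> Poly_Mapping.keys (p + q)"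
  then have "m \<in> Poly_Mapping.keys p \<union> Poly_Mapping.keys q" using Poly_Mapping.keys_add by (rule rev_subsetD)
  then show "(\<Sum>i\<in>UNIV. Poly_Mapping.lookup m (Inl i)) = d \<and> (\<Sum>j\<in>UNIV. Poly_Mapping.lookup m (Inr j)) = e"
    using assms unfolding bihomogeneous_def by blast
qed

lemma bihomogeneous_sum:
  assumes "\<And>i. i \<in> A \<Longrightarrow> bihomogeneous d e (f i)"
  shows "bihomogeneous d e (\<Sum>i\<in>A. f i)"
  using assms
proof (induction A rule: infinite_finite_induct)
  case (insert x A)
  then show ?case by (simp add: bihomogeneous_add)
qed (auto simp: bihomogeneous_def)

lemma eval_mpoly_sum: "eval_mpoly (\<Sum>i\<in>A. f i) a = (\<Sum>i\<in>A. eval_mpoly (f i) a)"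
  by (induction A rule: infinite_finite_induct) (auto simp: eval_mpoly_add, auto simp: eval_mpoly_def)

lemma sum_when_eq: "(\<Sum>i\<in>(UNIV :: 'i::finite set). (c when k = i)) = c"
  by (simp add: when_def)

text \<open>The map \<open>\<iota>\<close> selects the block of variables: \<open>Inl\<close> gives
  forms in x and \<open>Inr\<close> forms in y.\<close>

definition linear_form_mpoly :: "('i::finite \<Rightarrow> 'v) \<Rightarrow> 'a::comm_semiring_1 ^ 'i \<Rightarrow> ('v::finite, 'a) mpolynomial" where
  "linear_form_mpoly \<iota> u = (\<Sum>i\<in>UNIV. Poly_Mapping.single (Poly_Mapping.single (\<iota> i) 1) (u $ i))"

definition bilinear_form_mpoly :: "'a::comm_semiring_1 ^ 'n2::finite ^ 'n1::finite \<Rightarrow> ('n1 + 'n2, 'a) mpolynomial" where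
  "bilinear_form_mpoly V = (\<Sum>i\<in>UNIV. \<Sum>j\<in>UNIV.
     Poly_Mapping.single (Poly_Mapping.single (Inl i) 1 + Poly_Mapping.single (Inr j) 1) (V $ i $ j))"

lemma eval_linear_form: "eval_mpoly (linear_form_mpoly \<iota> u) a = (\<Sum>i\<in>UNIV. u $ i * a (\<iota> i))"
  by (simp only: linear_form_mpoly_def eval_mpoly_sum eval_mpoly_single prod_power_single)

lemma eval_bilinear_form:
  "eval_mpoly (bilinear_form_mpoly V) a = (\<Sum>i\<in>UNIV. \<Sum>j\<in>UNIV. V $ i $ j * a (Inl i) * a (Inr j))"
  by (simp only: bilinear_form_mpoly_def eval_mpoly_sum eval_mpoly_single lookup_add power_add prod.distrib
      prod_power_single mult.assoc)

lemma linear_bilinear_forms_in_bilinear_polys: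
  "linear_form_mpoly Inl u \<in> bilinear_polys" "linear_form_mpoly Inr u' \<in> bilinear_polys"
  "bilinear_form_mpoly V \<in> bilinear_polys"
proof -
  have "bihomogeneous 1 0 (linear_form_mpoly Inl u)"
    unfolding linear_form_mpoly_def
    by (intro bihomogeneous_sum bihomogeneous_single) (auto simp: lookup_single sum_when_eq)
  moreover have "bihomogeneous 0 1 (linear_form_mpoly Inr u')"
    unfolding linear_form_mpoly_def
    by (intro bihomogeneous_sum bihomogeneous_single) (auto simp: lookup_single sum_when_eq)
  moreover have "bihomogeneous 1 1 (bilinear_form_mpoly V)"
    unfolding bilinear_form_mpoly_def
    by (intro bihomogeneous_sum bihomogeneous_single) (auto simp: lookup_single lookup_add sum_when_eq)
  ultimately show "linear_form_mpoly Inl u \<in> bilinear_polys" "linear_form_mpoly Inr u' \<in> bilinear_polys"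
    "bilinear_form_mpoly V \<in> bilinear_polys" by (auto simp: bilinear_polys_def)
qed

text \<open>The trilinear form of a slice is a product of two factors, and the one free of z is
  taken: the linear form of \<open>u\<close> for the first two kinds, the bilinear form of
  \<open>V\<close> for the third.\<close>

lemma slice_tensor_polynomial:
  fixes S :: "('a::comm_semiring_1, 'n1::finite, 'n2::finite, 'n3::finite) tensor"
  assumes "slice_tensor S"
  shows "\<exists>f\<in>bilinear_polys. \<forall>a. eval_mpoly f a = 0 \<longrightarrow>
    (\<forall>z. trilinear S (\<chi> i. a (Inl i)) (\<chi> j. a (Inr j)) z = 0)"
  using assms unfolding slice_tensor_def
proof (elim disjE exE)
  fix u :: "'a ^ 'n1" and V :: "'a ^ 'n3 ^ 'n2" assume S: "S = (\<chi> i j k. u $ i * V $ j $ k)"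
  have "trilinear S x y z = (\<Sum>i\<in>UNIV. u $ i * x $ i) * (\<Sum>j\<in>UNIV. \<Sum>k\<in>UNIV. V $ j $ k * y $ j * z $ k)" for x y z
    by (subst sum_distrib_right) (simp add: S trilinear_def sum_distrib_left mult_ac)
  then show ?thesis
    by (intro bexI[of _ "linear_form_mpoly Inl u"])
      (auto simp: eval_linear_form linear_bilinear_forms_in_bilinear_polys)
next
  fix u :: "'a ^ 'n2" and V :: "'a ^ 'n3 ^ 'n1" assume S: "S = (\<chi> i j k. u $ j * V $ i $ k)"
  have "trilinear S x y z = (\<Sum>i\<in>UNIV. (\<Sum>j\<in>UNIV. u $ j * y $ j) * (\<Sum>k\<in>UNIV. V $ i $ k * x $ i * z $ k))" for x y z
    by (simp add: S trilinear_def sum_product mult_ac)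
  then show ?thesis
    by (intro bexI[of _ "linear_form_mpoly Inr u"])
      (auto simp: eval_linear_form linear_bilinear_forms_in_bilinear_polys)
next
  fix u :: "'a ^ 'n3" and V :: "'a ^ 'n2 ^ 'n1" assume S: "S = (\<chi> i j k. u $ k * V $ i $ j)"
  have "trilinear S x y z = (\<Sum>i\<in>UNIV. \<Sum>j\<in>UNIV. V $ i $ j * x $ i * y $ j) * (\<Sum>k\<in>UNIV. u $ k * z $ k)" for x y z
    by (simp add: S trilinear_def sum_distrib_right sum_distrib_left mult_ac)
  then show ?thesis
    by (intro bexI[of _ "bilinear_form_mpoly V"])
      (auto simp: eval_bilinear_form linear_bilinear_forms_in_bilinear_polys)
qed

lemma trilinear_sum_list:
  "trilinear (sum_list Ss) x y z = (\<Sum>S\<leftarrow>Ss. trilinear S x y z)"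
  by (induction Ss) (auto simp: trilinear_def distrib_right sum.distrib)

text \<open>Ensures that the minimum defining the slice rank is attained; the tensor is cut along
  its first index.\<close>

lemma exists_slice_decomposition:
  fixes T :: "('a::comm_semiring_1, 'n1::finite, 'n2::finite, 'n3::finite) tensor"
  shows "\<exists>Ss. (\<forall>S\<in>set Ss. slice_tensor S) \<and> T = sum_list Ss"
proof -
  define S where "S l = (\<chi> i j k. (\<chi> i. if i = l then 1 else 0) $ i * (T $ l) $ j $ k)" for l :: 'n1
  obtain ls :: "'n1 list" where ls: "set ls = UNIV" "distinct ls" using finite_distinct_list[OF finite] by blast
  have "slice_tensor (S l :: ('a, 'n1, 'n2, 'n3) tensor)" for l unfolding slice_tensor_def S_def by blast
  moreover have "T = sum_list (map S ls)"
  proof -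
    have "S l $ i $ j $ k = (if i = l then T $ l $ j $ k else 0)" for l i j k
      by (simp add: S_def)
    then show ?thesis
      by (simp add: sum_list_distinct_conv_sum_set[OF ls(2)] ls(1) vec_eq_iff)
  qed
  ultimately show ?thesis by (intro exI[of _ "map S ls"]) auto
qed

lemma pair_point_surj: "a = pair_point (\<chi> i. a (Inl i), \<chi> j. a (Inr j))"
  by (auto simp: fun_eq_iff pair_point_def split: sum.split)

lemma slice_decomposition_zero_locus:
  fixes Ss :: "('a::comm_semiring_1, 'n1::finite, 'n2::finite, 'n3::finite) tensor list"
  assumes "\<forall>S\<in>set Ss. slice_tensor S"
  shows "\<exists>fs :: ('n1 + 'n2, 'a) mpolynomial list. length fs = length Ss \<and> set fs \<subseteq> bilinear_polys \<and>
    zero_locus (set fs) \<subseteq> pair_point ` tensor_variety (sum_list Ss)"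
proof -
  obtain F where F: "\<forall>S\<in>set Ss. F S \<in> bilinear_polys \<and> (\<forall>a. eval_mpoly (F S) a = 0 \<longrightarrow>
    (\<forall>z. trilinear S (\<chi> i. a (Inl i)) (\<chi> j. a (Inr j)) z = 0))"
    using bchoice[of "set Ss" "\<lambda>S f. f \<in> bilinear_polys \<and> (\<forall>a. eval_mpoly f a = 0 \<longrightarrow>
      (\<forall>z. trilinear S (\<chi> i. a (Inl i)) (\<chi> j. a (Inr j)) z = 0))"] slice_tensor_polynomial assms by blast
  have "zero_locus (F ` set Ss) \<subseteq> pair_point ` tensor_variety (sum_list Ss)"
  proof
    fix a assume a: "a \<in> zero_locus (F ` set Ss)"
    have "trilinear (sum_list Ss) (\<chi> i. a (Inl i)) (\<chi> j. a (Inr j)) z = 0" for z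
    proof -
      have "map (\<lambda>S. trilinear S (\<chi> i. a (Inl i)) (\<chi> j. a (Inr j)) z) Ss = map (\<lambda>_. 0) Ss"
        using a F by (intro map_cong) (auto simp: zero_locus_def)
      then show ?thesis unfolding trilinear_sum_list by (simp only: sum_list_0)
    qed
    then have "(\<chi> i. a (Inl i), \<chi> j. a (Inr j)) \<in> tensor_variety (sum_list Ss)" by (simp add: tensor_variety_def)
    then show "a \<in> pair_point ` tensor_variety (sum_list Ss)" using pair_point_surj by (rule image_eqI[rotated])
  qed
  then show ?thesis using F by (intro exI[of _ "map F Ss"]) auto
qed

theorem theorem7p1:
  fixes T :: "('a::alg_closed_field, 'n1::finite, 'n2::finite, 'n3::finite) tensor"
  shows "geometric_rank T \<le> enat (zero_rank T) \<and> zero_rank T \<le> slice_rank T"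
proof -
  let ?ZR = "\<lambda>s. \<exists>fs :: ('n1 + 'n2, 'a) mpolynomial list. length fs = s \<and> set fs \<subseteq> bilinear_polys \<and>
    zero_locus (set fs) \<subseteq> pair_point ` tensor_variety T"
  let ?SR = "\<lambda>r. \<exists>Ss :: ('a, 'n1, 'n2, 'n3) tensor list. length Ss = r \<and> (\<forall>S\<in>set Ss. slice_tensor S) \<and> T = sum_list Ss"
  have "\<exists>r. ?SR r" using exists_slice_decomposition[of T] by blast
  then have "?SR (slice_rank T)" unfolding slice_rank_def by (rule LeastI_ex)
  \<comment> \<open>This gives the second inequality and also shows that the minimum defining
    \<open>zero_rank\<close> is attained.\<close>
  then have ZR: "?ZR (slice_rank T)" using slice_decomposition_zero_locus by metis
  then have le: "zero_rank T \<le> slice_rank T" unfolding zero_rank_def by (rule Least_le)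
  have "?ZR (zero_rank T)" unfolding zero_rank_def using ZR by (rule LeastI)
  then obtain fs :: "('n1 + 'n2, 'a) mpolynomial list" where
    fs: "length fs = zero_rank T" "set fs \<subseteq> bilinear_polys" "zero_locus (set fs) \<subseteq> pair_point ` tensor_variety T"
    by blast
  let ?N = "CARD('n1) + CARD('n2)"
  have N: "CARD('n1 + 'n2) = ?N" by simp
  have "geometric_rank T \<le> enat (zero_rank T)"
  proof (cases "zero_rank T < ?N")
    case True
    have "\<forall>i<zero_rank T. \<exists>k\<ge>1. eval_mpoly (fs ! i) \<in> forms k"
    proof (intro allI impI)
      fix i assume "i < zero_rank T"
      then have "fs ! i \<in> bilinear_polys" using fs(1,2) by (metis nth_mem subsetD)
      then have "bihomogeneous 1 0 (fs ! i) \<or> bihomogeneous 0 1 (fs ! i) \<or> bihomogeneous 1 1 (fs ! i)"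
        by (simp add: bilinear_polys_def)
      then have "eval_mpoly (fs ! i) \<in> forms 1 \<or> eval_mpoly (fs ! i) \<in> forms 2"
        using bihomogeneous_forms[of 1 0 "fs ! i"] bihomogeneous_forms[of 0 1 "fs ! i"]
          bihomogeneous_forms[of 1 1 "fs ! i"] by (auto simp: numeral_2_eq_2)
      then show "\<exists>k\<ge>1. eval_mpoly (fs ! i) \<in> forms k" by (metis one_le_numeral order_refl)
    qed
    then obtain dg where dg: "\<And>i. i < zero_rank T \<Longrightarrow> dg i \<ge> 1" "\<And>i. i < zero_rank T \<Longrightarrow> eval_mpoly (fs ! i) \<in> forms (dg i)"
      by metis
    have "(\<lambda>i. eval_mpoly (fs ! i)) ` {..<zero_rank T} = eval_mpoly ` set fs"
      by (auto simp: set_conv_nth fs(1))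
    then have "zeros ((\<lambda>i. eval_mpoly (fs ! i)) ` {..<zero_rank T}) \<subseteq> pair_point ` tensor_variety T"
      using fs(3) by (simp add: zero_locus_eq_zeros)
    then have "enat (?N - zero_rank T) \<le> dim_alg (pair_point ` tensor_variety T)"
      using dim_zeros_forms_ge[of "zero_rank T" "\<lambda>i. eval_mpoly (fs ! i)" dg] dg True unfolding N by blast
    \<comment> \<open>If the dimension is infinite, the subtraction in \<open>enat\<close> gives 0;
      otherwise the bound just shown applies.\<close>
    then show ?thesis
      unfolding geometric_rank_def by (cases "dim_alg (pair_point ` tensor_variety T)") auto
  next
    \<comment> \<open>Here \<open>?N\<close> is at most the zero rank, and the geometric rank never
      exceeds \<open>?N\<close>.\<close>
    case False
    then show ?thesis
      unfolding geometric_rank_def by (cases "dim_alg (pair_point ` tensor_variety T)") auto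
  qed
  with le show ?thesis by blast
qed

end
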